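(* Let $(\Omega,\mathcal F,\mathsf P)$ be a probability space, let $\mathcal V^1,\dots,\mathcal V^N$ be non-empty convex, $L^1$-closed, uniformly integrable subsets of $\mathcal P$, let $L_s^1=\bigcap_{n=1}^N L_s^1(\mathcal V^n)$, and let $A$ be a non-empty convex subset of $L_s^1$. Then the No Strictly Acceptable Opportunities condition $A\cap\mathcal A=\emptyset$ is satisfied if and only if $$\Bigl(\bigcap_{n=1}^N\mathcal V^n\Bigr)\cap\mathcal R\neq\emptyset .$$
   Context: $L^0$ is the space of all (real-valued) random variables on $(\Omega,\mathcal F,\mathsf P)$. $\mathcal P$ is the set of probability measures on $(\Omega,\mathcal F)$ absolutely continuous with respect to $\mathsf P$; measures in $\mathcal P$ are identified with their densities with respect to $\mathsf P$, so "$L^1$-closed" and "uniformly integrable" refer to the sets of densities in $L^1(\mathsf P)$. For $\mathsf Q\in\mathcal P$ and $X\in L^0$, the expectation is $\mathsf E_{\mathsf Q}X=\mathsf E_{\mathsf Q}X^+-\mathsf E_{\mathsf Q}X^-$ with the convention $\infty-\infty=-\infty$. For $\mathcal D\subseteq\mathcal P$, $$L_s^1(\mathcal D)=\Bigl\{X\in L^0:\lim_{k\to\infty}\sup_{\mathsf Q\in\mathcal D}\mathsf E_{\mathsf Q}\bigl[|X|\,I(|X|>k)\bigr]=0\Bigr\}.$$ The set of strictly acceptable opportunities for the $n$-th group is $$\mathcal A^n=\bigl\{X\in L_s^1:\inf_{\mathsf Q\in\mathcal V^n}\mathsf E_{\mathsf Q}X>0\bigr\}.$$ The set of strictly acceptable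 opportunities (convolution-based) is $$\mathcal A=\Bigl\{X\in L_s^1:\exists X^1,\dots,X^N\in L_s^1\text{ such that }\sum_{n=1}^N X^n=X\text{ and }X^n\in\mathcal A^n\text{ for all }n\Bigr\}.$$ The set of risk-neutral measures is $$\mathcal R=\{\mathsf Q\in\mathcal P:\mathsf E_{\mathsf Q}X\le 0\text{ for any }X\in A\}.$$ *)

theory Defs
  imports "HOL-Probability.Probability"
begin

definition ac_measures :: "'a measure \<Rightarrow> 'a measure set" where
  "ac_measures M = {Q. prob_space Q \<and> sets Q = sets M \<and> absolutely_continuous M Q}"

text \<open>The density of \<open>Q\<close> with respect to \<open>M\<close>; the Radon-Nikodym derivative is almost
  everywhere finite for \<open>Q \<in> ac_measures M\<close>, so passing to real values loses nothing.\<close>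

definition dens :: "'a measure \<Rightarrow> 'a measure \<Rightarrow> 'a \<Rightarrow> real" where
  "dens M Q \<omega> = enn2real (RN_deriv M Q \<omega>)"

definition convex_measures :: "'a measure \<Rightarrow> 'a measure set \<Rightarrow> bool" where
  "convex_measures M D \<longleftrightarrow>
     (\<forall>Q1\<in>D. \<forall>Q2\<in>D. \<forall>t\<in>{0..1}. \<exists>Q\<in>D. \<forall>E\<in>sets M.
        measure Q E = t * measure Q1 E + (1 - t) * measure Q2 E)"

definition L1_closed :: "'a measure \<Rightarrow> 'a measure set \<Rightarrow> bool" where
  "L1_closed M D \<longleftrightarrow>
     (\<forall>(Q :: nat \<Rightarrow> 'a measure) f. (\<forall>k. Q k \<in> D) \<and> integrable M f \<and>
        (\<lambda>k. \<integral>\<omega>. \<bar>dens M (Q k) \<omega> - f \<omega>\<bar> \<partial>M) \<longlonglongrightarrow> 0 \<longrightarrow>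
        (\<exists>R\<in>D. AE \<omega> in M. dens M R \<omega> = f \<omega>))"

definition uniformly_integrable_measures :: "'a measure \<Rightarrow> 'a measure set \<Rightarrow> bool" where
  "uniformly_integrable_measures M D \<longleftrightarrow>
     ((\<lambda>k::real. SUP Q\<in>D.
         \<integral>\<^sup>+\<omega>. ennreal (dens M Q \<omega>) * indicator {\<omega>. dens M Q \<omega> > k} \<omega> \<partial>M) \<longlongrightarrow> 0) at_top"

text \<open>Expectation with the convention \<open>\<infinity> - \<infinity> = -\<infinity>\<close>. The case distinction is needed
  because subtraction on type \<open>ereal\<close> satisfies \<open>\<infinity> - \<infinity> = \<infinity>\<close>.\<close>

definition expect :: "'a measure \<Rightarrow> ('a \<Rightarrow> real) \<Rightarrow> ereal" where
  "expect Q X =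
     (let p = \<integral>\<^sup>+\<omega>. ennreal (max 0 (X \<omega>)) \<partial>Q; m = \<integral>\<^sup>+\<omega>. ennreal (max 0 (- X \<omega>)) \<partial>Q
      in if m = \<infinity> then - \<infinity> else enn2ereal p - enn2ereal m)"

definition L1s :: "'a measure \<Rightarrow> 'a measure set \<Rightarrow> ('a \<Rightarrow> real) set" where
  "L1s M D = {X \<in> borel_measurable M.
     ((\<lambda>k::real. SUP Q\<in>D.
         \<integral>\<^sup>+\<omega>. ennreal \<bar>X \<omega>\<bar> * indicator {\<omega>. \<bar>X \<omega>\<bar> > k} \<omega> \<partial>Q) \<longlongrightarrow> 0) at_top}"

text \<open>The family of sets of measures is indexed by \<open>n \<in> {1..N}\<close>; values of \<open>V\<close> at other
  indices are irrelevant.\<close>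

definition L1s_common ::
    "'a measure \<Rightarrow> nat \<Rightarrow> (nat \<Rightarrow> 'a measure set) \<Rightarrow> ('a \<Rightarrow> real) set" where
  "L1s_common M N V = (\<Inter>n\<in>{1..N}. L1s M (V n))"

definition group_acceptable ::
    "'a measure \<Rightarrow> nat \<Rightarrow> (nat \<Rightarrow> 'a measure set) \<Rightarrow> nat \<Rightarrow> ('a \<Rightarrow> real) set" where
  "group_acceptable M N V n = {X \<in> L1s_common M N V. (INF Q\<in>V n. expect Q X) > 0}"

text \<open>Random variables are plain functions here, not classes modulo almost sure equality.
  Equations between them are therefore stated almost everywhere, both here and in
  \<open>convex_rvs\<close>.\<close>

definition acceptable ::
    "'a measure \<Rightarrow> nat \<Rightarrow> (nat \<Rightarrow> 'a measure set) \<Rightarrow> ('a \<Rightarrow> real) set" where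
  "acceptable M N V = {X \<in> L1s_common M N V.
     \<exists>Y :: nat \<Rightarrow> 'a \<Rightarrow> real.
       (\<forall>n\<in>{1..N}. Y n \<in> L1s_common M N V) \<and>
       (AE \<omega> in M. (\<Sum>n=1..N. Y n \<omega>) = X \<omega>) \<and>
       (\<forall>n\<in>{1..N}. Y n \<in> group_acceptable M N V n)}"

definition convex_rvs :: "'a measure \<Rightarrow> ('a \<Rightarrow> real) set \<Rightarrow> bool" where
  "convex_rvs M A \<longleftrightarrow>
     (\<forall>X\<in>A. \<forall>Y\<in>A. \<forall>t\<in>{0..1}. \<exists>Z\<in>A. AE \<omega> in M. Z \<omega> = t * X \<omega> + (1 - t) * Y \<omega>)"

definition risk_neutral :: "'a measure \<Rightarrow> ('a \<Rightarrow> real) set \<Rightarrow> 'a measure set" where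
  "risk_neutral M A = {Q \<in> ac_measures M. \<forall>X\<in>A. expect Q X \<le> 0}"

end

theory Submission
  imports Defs
begin

text \<open>
Let \<open>Q\<close> be a risk-neutral measure that belongs to all the sets \<open>V n\<close>. If an \<open>X\<close> in \<open>A\<close> were a sum of shares
that are strictly acceptable for their groups, then all shares would have positive expectation under
\<open>Q\<close>, hence so would \<open>X\<close> (\<open>expect_sum_pos\<close>), which contradicts risk neutrality.

For the converse, pair a decomposition \<open>(Y n)\<close> of an element of \<open>A\<close> with a tuple \<open>(Q n)\<close> of measures,
\<open>Q n \<in> V n\<close>, by summing the expectations of \<open>Y n\<close> under \<open>Q n\<close>. If this sum had a positive infimum over
all tuples, it could be divided equally among the groups by adding constants of sum zero to the
shares, and the element of \<open>A\<close> would be strictly acceptable (\<open>acceptable_of_pairing_bound\<close>). So in the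
absence of strictly acceptable opportunities every decomposition has, for every \<open>\<delta> > 0\<close>, a tuple whose
pairing with it is below \<open>\<delta>\<close>. A minimax theorem exchanges the quantifiers: a single tuple pairs
nonpositively with all decompositions (\<open>separating_tuple\<close>). Since arbitrary multiples of an indicator
may be moved from one share to another without changing the sum, the measures in that tuple
coincide (\<open>separating_tuple_diagonal\<close>); their common value lies in all \<open>V n\<close>, and it is risk-neutral
because the decompositions include \<open>(X, 0, ..., 0)\<close> for \<open>X\<close> in \<open>A\<close>.

The minimax theorem rests on compactness. A uniformly integrable, convex, closed set of densities is
weakly compact by the Dunford-Pettis theorem, but only the consequence for closed convex subsets
matters: if any finitely many of them meet, they all meet. This has a metric proof. The function
\<open>f \<mapsto> E exp (- f)\<close> is bounded on densities, and uniform integrability makes it uniformly convex for the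
\<open>L\<^sup>1\<close> distance (\<open>densities_uniformly_convex\<close>), because its convexity defect at a midpoint is half the
expectation of \<open>(exp (- f / 2) - exp (- g / 2))\<^sup>2\<close>. Points that nearly minimize it over smaller and smaller
intersections therefore form a Cauchy sequence, whose limit lies in every member of the family
(\<open>finite_intersection_property\<close>). With this, minimax reduces to finitely many functions, where it
follows from an elementary argument in the plane (\<open>minimax_two\<close>) by induction.
\<close>

section \<open>Minimax on uniformly convex domains\<close>

text \<open>A substitute for weak compactness. In a complete metric space that carries a bounded, uniformly
convex function, minimizing sequences over shrinking convex sets are Cauchy, exactly as in the
construction of the projection onto a closed convex subset of a Hilbert space. The distance may
vanish between different points, so that functions can serve as points although they matter only up
to null sets.\<close>

locale uniformly_convex_domain =
  fixes D :: "'f set" and \<rho> :: "'f \<Rightarrow> 'f \<Rightarrow> real"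
    and mix :: "real \<Rightarrow> 'f \<Rightarrow> 'f \<Rightarrow> 'f" and J :: "'f \<Rightarrow> real"
  assumes dist_nonneg: "\<And>x y. 0 \<le> \<rho> x y"
    and dist_triangle: "\<And>x y z. x \<in> D \<Longrightarrow> y \<in> D \<Longrightarrow> z \<in> D \<Longrightarrow> \<rho> x z \<le> \<rho> x y + \<rho> y z"
    and complete: "\<And>u. (\<And>k::nat. u k \<in> D) \<Longrightarrow>
        (\<And>e. 0 < e \<Longrightarrow> \<exists>K. \<forall>k\<ge>K. \<forall>m\<ge>K. \<rho> (u k) (u m) < e) \<Longrightarrow>
        \<exists>l\<in>D. (\<lambda>k. \<rho> (u k) l) \<longlonglongrightarrow> 0"
    and mix_closed: "\<And>t x y. t \<in> {0..1} \<Longrightarrow> x \<in> D \<Longrightarrow> y \<in> D \<Longrightarrow> mix t x y \<in> D"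
    and J_bdd_below: "bdd_below (J ` D)"
    and J_bdd_above: "bdd_above (J ` D)"
    and J_uniformly_convex: "\<And>e. 0 < e \<Longrightarrow> \<exists>d>0. \<forall>x\<in>D. \<forall>y\<in>D.
        (J x + J y) / 2 - J (mix (1/2) x y) < d \<longrightarrow> \<rho> x y < e"
begin

text \<open>For a finite subfamily \<open>S\<close> let \<open>s S\<close> be the infimum of \<open>J\<close> over its intersection, and let \<open>t\<close> be
the supremum of these numbers. If \<open>s S\<close> is close to \<open>t\<close>, two points of the intersection of \<open>S\<close> at which \<open>J\<close> is
close to \<open>t\<close> have their midpoint in the same intersection, where \<open>J\<close> is at least \<open>s S\<close>; uniform convexity
makes such points close to each other. Hence near-minimizers \<open>x k\<close> along a sequence of intersections
that exhausts \<open>t\<close> converge, and for any further member \<open>G\<close> of the family near-minimizers \<open>y k\<close> that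
also lie in \<open>G\<close> converge to the same point, which thus belongs to \<open>G\<close>.\<close>

lemma finite_intersection_property:
  assumes mid: "\<And>G x y. G \<in> \<G> \<Longrightarrow> x \<in> G \<Longrightarrow> y \<in> G \<Longrightarrow> mix (1/2) x y \<in> G"
    and closed: "\<And>G u l. G \<in> \<G> \<Longrightarrow> (\<And>k::nat. u k \<in> G) \<Longrightarrow> l \<in> D \<Longrightarrow>
        (\<lambda>k. \<rho> (u k) l) \<longlonglongrightarrow> 0 \<Longrightarrow> l \<in> G"
    and fin: "\<And>S. finite S \<Longrightarrow> S \<subseteq> \<G> \<Longrightarrow> D \<inter> \<Inter>S \<noteq> {}"
  shows "\<exists>x\<in>D. \<forall>G\<in>\<G>. x \<in> G"
proof -
  define Fin where "Fin = {S. finite S \<and> S \<subseteq> \<G>}"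
  define s where "s S = Inf (J ` (D \<inter> \<Inter>S))" for S
  define t where "t = Sup (s ` Fin)"
  have below: "bdd_below (J ` (D \<inter> \<Inter>S))" for S
    by (rule bdd_below_mono[OF J_bdd_below]) auto
  obtain b where b: "\<And>x. x \<in> D \<Longrightarrow> J x \<le> b"
    using J_bdd_above by (auto simp: bdd_above_def)
  have sle: "s S \<le> J x" if "x \<in> D \<inter> \<Inter>S" for x S
    unfolding s_def by (rule cInf_lower[OF _ below]) (use that in auto)
  have "s S \<le> b" if S: "S \<in> Fin" for S
  proof -
    obtain x where "x \<in> D \<inter> \<Inter>S" using fin[of S] S unfolding Fin_def by blast
    then show ?thesis using sle[of x S] b[of x] by simp
  qed
  then have bdd: "bdd_above (s ` Fin)" by (auto simp: bdd_above_def)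
  have st: "s S \<le> t" if "S \<in> Fin" for S
    unfolding t_def using that bdd by (intro cSup_upper) auto
  have "{} \<in> Fin" by (simp add: Fin_def)
  have "\<exists>S\<in>Fin. t - 1 / real (Suc k) < s S" for k
  proof -
    have "t - 1 / real (Suc k) < Sup (s ` Fin)" unfolding t_def by simp
    from less_cSupD[OF _ this] \<open>{} \<in> Fin\<close> show ?thesis by blast
  qed
  then have "\<forall>k. \<exists>S. S \<in> Fin \<and> t - 1 / real (Suc k) < s S" by blast
  from choice[OF this] obtain S where S: "\<And>k. S k \<in> Fin" "\<And>k. t - 1 / real (Suc k) < s (S k)"
    by blast
  \<comment> \<open>Accumulating the subfamilies makes the intersections decrease, so that later points lie in earlier intersections.\<close>
  define T where "T k = (\<Union>i\<le>k. S i)" for k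
  have T: "T k \<in> Fin" for k using S(1) unfolding Fin_def T_def by blast
  have Tmono: "T k \<subseteq> T m" if "k \<le> m" for k m unfolding T_def by (rule UN_mono) (use that in auto)
  have sT: "t - 1 / real (Suc k) \<le> J x" if "x \<in> D \<inter> \<Inter>(T k)" for k x
  proof -
    have "S k \<subseteq> T k" unfolding T_def by blast
    then have "x \<in> D \<inter> \<Inter>(S k)" using that by blast
    from sle[OF this] S(2)[of k] show ?thesis by linarith
  qed
  have near: "\<exists>x. x \<in> D \<inter> \<Inter>R \<and> J x \<le> t + 1 / real (Suc k)" if "R \<in> Fin" for R k
  proof -
    have "s R < t + 1 / real (Suc k)"
    proof -
      have "0 < 1 / real (Suc k)" by simp
      with st[OF that] show ?thesis by linarith
    qed
    then have lt: "Inf (J ` (D \<inter> \<Inter>R)) < t + 1 / real (Suc k)" unfolding s_def .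
    have "J ` (D \<inter> \<Inter>R) \<noteq> {}" using fin[of R] that unfolding Fin_def by blast
    from cInf_lessD[OF this lt] obtain x where "x \<in> D \<inter> \<Inter>R" "J x < t + 1 / real (Suc k)" by blast
    then show ?thesis using less_imp_le by blast
  qed
  have key: "\<exists>K. \<forall>k\<ge>K. \<forall>x\<in>D \<inter> \<Inter>(T k). \<forall>y\<in>D \<inter> \<Inter>(T k).
      J x \<le> t + 1 / real (Suc k) \<longrightarrow> J y \<le> t + 1 / real (Suc k) \<longrightarrow> \<rho> x y < e" if e: "0 < e" for e
  proof -
    obtain d where d: "0 < d" "\<And>x y. x \<in> D \<Longrightarrow> y \<in> D \<Longrightarrow>
        (J x + J y) / 2 - J (mix (1/2) x y) < d \<Longrightarrow> \<rho> x y < e"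
      using J_uniformly_convex[OF e] by blast
    obtain K where K: "1 / real (Suc K) < d / 2"
      using d(1) by (metis half_gt_zero inverse_eq_divide reals_Archimedean)
    show ?thesis
    proof (intro exI[of _ K] allI impI ballI)
      fix k x y
      assume k: "K \<le> k" and x: "x \<in> D \<inter> \<Inter>(T k)" and y: "y \<in> D \<inter> \<Inter>(T k)"
        and J: "J x \<le> t + 1 / real (Suc k)" "J y \<le> t + 1 / real (Suc k)"
      have "mix (1/2) x y \<in> D \<inter> \<Inter>(T k)"
      proof (intro IntI InterI)
        show "mix (1/2) x y \<in> D" using x y by (intro mix_closed) auto
        fix G assume "G \<in> T k"
        then show "mix (1/2) x y \<in> G" using x y mid[of G x y] T[of k] unfolding Fin_def by blast
      qed
      from sT[OF this] have J_mix: "t - 1 / real (Suc k) \<le> J (mix (1/2) x y)" .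
      define a where "a = 1 / real (Suc k)"
      have "1 / real (Suc k) \<le> 1 / real (Suc K)" using k by (simp add: frac_le)
      with K have "a < d / 2" unfolding a_def by (rule le_less_trans[rotated])
      with J J_mix have "(J x + J y) / 2 - J (mix (1/2) x y) < d" unfolding a_def[symmetric] by argo
      then show "\<rho> x y < e" using d(2)[of x y] x y by blast
    qed
  qed
  obtain x where x: "\<And>k. x k \<in> D \<inter> \<Inter>(T k)" "\<And>k. J (x k) \<le> t + 1 / real (Suc k)"
  proof -
    have "\<forall>k. \<exists>x. x \<in> D \<inter> \<Inter>(T k) \<and> J x \<le> t + 1 / real (Suc k)" using near[OF T] by blast
    from choice[OF this] show ?thesis using that by blast
  qed
  have cauchy: "\<exists>K. \<forall>k\<ge>K. \<forall>m\<ge>K. \<rho> (x k) (x m) < e" if e: "0 < e" for e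
  proof -
    obtain K where K: "\<forall>x\<in>D \<inter> \<Inter>(T K). \<forall>y\<in>D \<inter> \<Inter>(T K).
      J x \<le> t + 1 / real (Suc K) \<longrightarrow> J y \<le> t + 1 / real (Suc K) \<longrightarrow> \<rho> x y < e"
      using key[OF e] by blast
    have "x k \<in> D \<inter> \<Inter>(T K)" "J (x k) \<le> t + 1 / real (Suc K)" if "K \<le> k" for k
    proof -
      show "x k \<in> D \<inter> \<Inter>(T K)" using x(1)[of k] Tmono[OF that] by blast
      have "1 / real (Suc k) \<le> 1 / real (Suc K)" using that by (simp add: frac_le)
      then have "t + 1 / real (Suc k) \<le> t + 1 / real (Suc K)" by (rule add_left_mono)
      with x(2)[of k] show "J (x k) \<le> t + 1 / real (Suc K)" by (rule order_trans)
    qed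
    with K show ?thesis by blast
  qed
  then obtain l where l: "l \<in> D" "(\<lambda>k. \<rho> (x k) l) \<longlonglongrightarrow> 0"
    using complete[OF _ cauchy] x(1) by blast
  have "l \<in> G" if G: "G \<in> \<G>" for G
  proof -
    have "insert G (T k) \<in> Fin" for k using T[of k] G by (auto simp: Fin_def)
    from near[OF this] have "\<forall>k. \<exists>y. y \<in> D \<inter> \<Inter>(insert G (T k)) \<and> J y \<le> t + 1 / real (Suc k)"
      by blast
    from choice[OF this] obtain y where
      y: "\<And>k. y k \<in> D \<inter> \<Inter>(insert G (T k))" "\<And>k. J (y k) \<le> t + 1 / real (Suc k)"
      by blast
    have xy: "(\<lambda>k. \<rho> (y k) (x k)) \<longlonglongrightarrow> 0"
    proof (rule LIMSEQ_I)
      fix e :: real assume "0 < e"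
      from key[OF this] obtain K where K: "\<forall>k\<ge>K. \<forall>x\<in>D \<inter> \<Inter>(T k). \<forall>y\<in>D \<inter> \<Inter>(T k).
          J x \<le> t + 1 / real (Suc k) \<longrightarrow> J y \<le> t + 1 / real (Suc k) \<longrightarrow> \<rho> x y < e" by blast
      show "\<exists>K. \<forall>k\<ge>K. norm (\<rho> (y k) (x k) - 0) < e"
      proof (intro exI[of _ K] allI impI)
        fix k assume "K \<le> k"
        moreover have "y k \<in> D \<inter> \<Inter>(T k)" using y(1)[of k] by auto
        ultimately have "\<rho> (y k) (x k) < e" using K x(1)[of k] x(2)[of k] y(2)[of k] by blast
        then show "norm (\<rho> (y k) (x k) - 0) < e" using dist_nonneg[of "y k" "x k"] by simp
      qed
    qed
    have "(\<lambda>k. \<rho> (y k) l) \<longlonglongrightarrow> 0"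
    proof (rule tendsto_sandwich[where f = "\<lambda>_. 0" and h = "\<lambda>k. \<rho> (y k) (x k) + \<rho> (x k) l"])
      show "(\<lambda>k. \<rho> (y k) (x k) + \<rho> (x k) l) \<longlonglongrightarrow> 0" using tendsto_add[OF xy l(2)] by simp
      show "\<forall>\<^sub>F k in sequentially. \<rho> (y k) l \<le> \<rho> (y k) (x k) + \<rho> (x k) l"
        using dist_triangle[OF _ _ l(1)] x(1) y(1) by simp
      show "\<forall>\<^sub>F k in sequentially. 0 \<le> \<rho> (y k) l" using dist_nonneg by simp
    qed simp
    then show "l \<in> G" using closed[OF G _ l(1), of y] y(1) by simp
  qed
  with l(1) show ?thesis by blast
qed

end

text \<open>The weights \<open>r\<close> that work at a point \<open>x\<close> form the interval below \<open>u x\<close> if \<open>f x < \<epsilon>\<close>, an interval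
bounded from below if \<open>g x < \<epsilon>\<close>, and everything otherwise. A lower bound coming from one point never
exceeds an upper bound coming from another one: otherwise some mixture of the two points would make
both \<open>f\<close> and \<open>g\<close> smaller than \<open>\<epsilon>\<close>.\<close>

lemma minimax_two:
  fixes f g :: "'f \<Rightarrow> real"
  assumes mix: "\<And>t x y. t \<in> {0..1} \<Longrightarrow> x \<in> D \<Longrightarrow> y \<in> D \<Longrightarrow> mix t x y \<in> D"
    and f: "\<And>t x y. t \<in> {0..1} \<Longrightarrow> x \<in> D \<Longrightarrow> y \<in> D \<Longrightarrow> f (mix t x y) = t * f x + (1 - t) * f y"
    and g: "\<And>t x y. t \<in> {0..1} \<Longrightarrow> x \<in> D \<Longrightarrow> y \<in> D \<Longrightarrow> g (mix t x y) = t * g x + (1 - t) * g y"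
    and max: "\<And>x. x \<in> D \<Longrightarrow> \<epsilon> \<le> f x \<or> \<epsilon> \<le> g x"
  shows "\<exists>r\<in>{0..1}. \<forall>x\<in>D. \<epsilon> \<le> r * f x + (1 - r) * g x"
proof -
  define a where "a x = f x - \<epsilon>" for x
  define b where "b x = g x - \<epsilon>" for x
  define u where "u x = b x / (b x - a x)" for x
  define U where "U = insert 1 (u ` {x\<in>D. a x < 0})"
  define r where "r = Inf U"
  have b0: "0 \<le> b x" if "x \<in> D" "a x < 0" for x
    using max[OF that(1)] that(2) by (auto simp: a_def b_def)
  have a0: "0 \<le> a x" if "x \<in> D" "b x < 0" for x
    using max[OF that(1)] that(2) by (auto simp: a_def b_def)
  have U0: "0 \<le> v" if "v \<in> U" for v
  proof -
    have "0 \<le> u z" if "z \<in> D" "a z < 0" for z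
      using b0[OF that] that(2) by (simp add: u_def)
    then show ?thesis using that by (auto simp: U_def)
  qed
  then have bdd: "bdd_below U" by (rule bdd_belowI)
  have r01: "0 \<le> r" "r \<le> 1"
    unfolding r_def using U0 cInf_lower[OF _ bdd, of 1] by (auto intro!: cInf_greatest simp: U_def)
  have cross: "a x * b y \<le> b x * a y" if x: "x \<in> D" "a x < 0" and y: "y \<in> D" "b y < 0" for x y
  proof (rule ccontr)
    assume neg: "\<not> ?thesis"
    \<comment> \<open>The weights for which \<open>p * a x + q * a y\<close> and \<open>p * b x + q * b y\<close> both equal \<open>b x * a y - a x * b y\<close>.\<close>
    define p where "p = a y - b y"
    define q where "q = b x - a x"
    have pq: "0 < p" "0 < q" using b0[OF x] a0[OF y] x y by (auto simp: p_def q_def)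
    define t where "t = p / (p + q)"
    have t: "t \<in> {0..1}" "t * (p + q) = p" "(1 - t) * (p + q) = q"
      using pq by (auto simp: t_def field_simps)
    have 1: "(p + q) * (t * z + (1 - t) * w) = p * z + q * w" for z w
    proof -
      have "(p + q) * (t * z + (1 - t) * w) = (t * (p + q)) * z + ((1 - t) * (p + q)) * w"
        by (simp add: algebra_simps)
      also have "\<dots> = p * z + q * w" by (simp only: t)
      finally show ?thesis .
    qed
    have "p * a x + q * a y < 0" "p * b x + q * b y < 0"
      using neg by (auto simp: p_def q_def algebra_simps)
    then have "t * a x + (1 - t) * a y < 0" "t * b x + (1 - t) * b y < 0"
      using pq by (auto simp flip: 1 simp: mult_less_0_iff)
    moreover have "f (mix t x y) - \<epsilon> = t * a x + (1 - t) * a y"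
      using f[OF t(1) x(1) y(1)] by (simp add: a_def algebra_simps)
    moreover have "g (mix t x y) - \<epsilon> = t * b x + (1 - t) * b y"
      using g[OF t(1) x(1) y(1)] by (simp add: b_def algebra_simps)
    ultimately show False using max[OF mix[OF t(1) x(1) y(1)]] by auto
  qed
  have "0 \<le> r * a x + (1 - r) * b x" if x: "x \<in> D" for x
  proof -
    consider "0 \<le> a x" "0 \<le> b x" | "a x < 0" | "b x < 0" by linarith
    then show ?thesis
    proof cases
      case 1 then show ?thesis using r01 by simp
    next
      case 2
      then have "u x \<in> U" using x by (simp add: U_def)
      then have "r \<le> u x" unfolding r_def by (rule cInf_lower[OF _ bdd])
      then have "r * (b x - a x) \<le> b x" using 2 b0[OF x 2] by (simp add: u_def pos_le_divide_eq)
      then show ?thesis by (simp add: algebra_simps)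
    next
      case 3
      note ax = a0[OF x 3]
      have "- b x / (a x - b x) \<le> v" if "v \<in> U" for v
      proof -
        have "- b x / (a x - b x) \<le> u z" if z: "z \<in> D" "a z < 0" for z
          using cross[OF z x 3] b0[OF z] z 3 ax by (simp add: u_def frac_le_eq divide_simps algebra_simps)
        moreover have "- b x / (a x - b x) \<le> 1" using 3 ax by (simp add: divide_simps)
        ultimately show ?thesis using that by (auto simp: U_def)
      qed
      then have "- b x / (a x - b x) \<le> r" unfolding r_def by (intro cInf_greatest) (auto simp: U_def)
      moreover have "0 < a x - b x" using 3 ax by simp
      ultimately have "- b x \<le> r * (a x - b x)" by (simp only: pos_divide_le_eq)
      then show ?thesis by (simp add: algebra_simps)
    qed
  qed
  then have "\<forall>x\<in>D. \<epsilon> \<le> r * f x + (1 - r) * g x" by (simp add: a_def b_def algebra_simps)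
  then show ?thesis using r01 by auto
qed

text \<open>Induction on the number of functions: on the convex set of points where the new function is below
\<open>\<epsilon>\<close>, the induction hypothesis gives one function for all the old ones, and the case of two functions
combines it with the new one. The domain has to vary in the induction.\<close>

lemma minimax_finite:
  fixes C :: "('f \<Rightarrow> real) set"
  assumes "finite S" "S \<noteq> {}" "S \<subseteq> C"
    and "\<And>t x y. t \<in> {0..1} \<Longrightarrow> x \<in> D \<Longrightarrow> y \<in> D \<Longrightarrow> mix t x y \<in> D"
    and "\<And>\<phi> t x y. \<phi> \<in> C \<Longrightarrow> t \<in> {0..1} \<Longrightarrow> x \<in> D \<Longrightarrow> y \<in> D \<Longrightarrow>
           \<phi> (mix t x y) = t * \<phi> x + (1 - t) * \<phi> y"
    and "\<And>\<phi> \<psi> t. \<phi> \<in> C \<Longrightarrow> \<psi> \<in> C \<Longrightarrow> t \<in> {0..1} \<Longrightarrow>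
           \<exists>\<theta>\<in>C. \<forall>x\<in>D. \<theta> x = t * \<phi> x + (1 - t) * \<psi> x"
    and "\<And>x. x \<in> D \<Longrightarrow> \<exists>\<phi>\<in>S. \<epsilon> \<le> \<phi> x"
  shows "\<exists>\<phi>\<in>C. \<forall>x\<in>D. \<epsilon> \<le> \<phi> x"
  using assms
proof (induction S arbitrary: D rule: finite_ne_induct)
  case (singleton \<phi>)
  then show ?case by (intro bexI[of _ \<phi>]) auto
next
  case (insert \<phi> S)
  note mix = insert.prems(2) and aff = insert.prems(3) and conv = insert.prems(4) and max = insert.prems(5)
  have \<phi>: "\<phi> \<in> C" using insert.prems(1) by auto
  let ?D = "{x\<in>D. \<phi> x < \<epsilon>}"
  have "\<exists>\<psi>\<in>C. \<forall>x\<in>?D. \<epsilon> \<le> \<psi> x"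
  proof (rule insert.IH)
    fix t :: real and x y assume t: "t \<in> {0..1}" and xy: "x \<in> ?D" "y \<in> ?D"
    have "t * \<phi> x + (1 - t) * \<phi> y < \<epsilon>"
      using xy t by (intro convex_bound_lt) auto
    then show "mix t x y \<in> ?D" using mix[OF t] aff[OF \<phi> t] xy by auto
  next
    fix \<phi> \<psi> and t :: real assume "\<phi> \<in> C" "\<psi> \<in> C" "t \<in> {0..1}"
    from conv[OF this] show "\<exists>\<theta>\<in>C. \<forall>x\<in>?D. \<theta> x = t * \<phi> x + (1 - t) * \<psi> x" by auto
  next
    fix x assume x: "x \<in> ?D"
    then obtain \<psi> where "\<psi> \<in> insert \<phi> S" "\<epsilon> \<le> \<psi> x" using max by blast
    with x show "\<exists>\<phi>\<in>S. \<epsilon> \<le> \<phi> x" by auto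
  qed (use insert.prems(1) aff in auto)
  then obtain \<psi> where \<psi>: "\<psi> \<in> C" "\<And>x. x \<in> D \<Longrightarrow> \<phi> x < \<epsilon> \<Longrightarrow> \<epsilon> \<le> \<psi> x" by auto
  have "\<exists>r\<in>{0..1}. \<forall>x\<in>D. \<epsilon> \<le> r * \<phi> x + (1 - r) * \<psi> x"
    by (rule minimax_two[OF mix aff[OF \<phi>] aff[OF \<psi>(1)]]) (use \<psi>(2) in force)+
  then obtain r where r: "r \<in> {0..1}" "\<forall>x\<in>D. \<epsilon> \<le> r * \<phi> x + (1 - r) * \<psi> x" by blast
  obtain \<theta> where "\<theta> \<in> C" "\<forall>x\<in>D. \<theta> x = r * \<phi> x + (1 - r) * \<psi> x"
    using conv[OF \<phi> \<psi>(1) r(1)] by blast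
  with r(2) show ?case by (intro bexI[of _ \<theta>]) auto
qed

text \<open>The sublevel sets \<open>{x \<in> D. \<phi> x \<le> \<delta>}\<close> with \<open>\<delta> > 0\<close> are closed and convex. If finitely many of them
did not meet, the functions involved would have a positive maximum bounded away from zero, and
\<open>minimax_finite\<close> would produce a single function in \<open>C\<close> with that lower bound, although every function
in \<open>C\<close> takes values below any positive number. So they all have a
common point by \<open>finite_intersection_property\<close>.\<close>

lemma (in uniformly_convex_domain) minimax:
  fixes C :: "('f \<Rightarrow> real) set"
  assumes aff: "\<And>\<phi> t x y. \<phi> \<in> C \<Longrightarrow> t \<in> {0..1} \<Longrightarrow> x \<in> D \<Longrightarrow> y \<in> D \<Longrightarrow>
           \<phi> (mix t x y) = t * \<phi> x + (1 - t) * \<phi> y"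
    and cont: "\<And>\<phi> u l. \<phi> \<in> C \<Longrightarrow> (\<And>k::nat. u k \<in> D) \<Longrightarrow> l \<in> D \<Longrightarrow>
           (\<lambda>k. \<rho> (u k) l) \<longlonglongrightarrow> 0 \<Longrightarrow> (\<lambda>k. \<phi> (u k)) \<longlonglongrightarrow> \<phi> l"
    and conv: "\<And>\<phi> \<psi> t. \<phi> \<in> C \<Longrightarrow> \<psi> \<in> C \<Longrightarrow> t \<in> {0..1} \<Longrightarrow>
           \<exists>\<theta>\<in>C. \<forall>x\<in>D. \<theta> x = t * \<phi> x + (1 - t) * \<psi> x"
    and inf: "\<And>\<phi> \<delta>. \<phi> \<in> C \<Longrightarrow> 0 < \<delta> \<Longrightarrow> \<exists>x\<in>D. \<phi> x < \<delta>"
    and ne: "D \<noteq> {}"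
  shows "\<exists>x\<in>D. \<forall>\<phi>\<in>C. \<phi> x \<le> 0"
proof -
  define B where "B p = {x\<in>D. fst p x \<le> (snd p :: real)}" for p
  have "\<exists>x\<in>D. \<forall>G\<in>B ` (C \<times> {0<..}). x \<in> G"
  proof (rule finite_intersection_property)
    fix G x y assume "G \<in> B ` (C \<times> {0<..})" and xy: "x \<in> G" "y \<in> G"
    from this(1) obtain p where p: "p \<in> C \<times> {0<..}" "G = B p" by blast
    define \<phi> \<delta> where "\<phi> = fst p" and "\<delta> = snd p"
    have \<phi>: "\<phi> \<in> C" "G = {x\<in>D. \<phi> x \<le> \<delta>}" using p by (auto simp: B_def \<phi>_def \<delta>_def)
    then have "\<phi> (mix (1/2) x y) = \<phi> x / 2 + \<phi> y / 2" using aff[of \<phi> "1/2" x y] xy by simp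
    then show "mix (1/2) x y \<in> G" using \<phi> xy mix_closed[of "1/2" x y] by simp
  next
    fix G l and u :: "nat \<Rightarrow> 'f"
    assume "G \<in> B ` (C \<times> {0<..})" and u: "\<And>k. u k \<in> G" and l: "l \<in> D" "(\<lambda>k. \<rho> (u k) l) \<longlonglongrightarrow> 0"
    from this(1) obtain p where p: "p \<in> C \<times> {0<..}" "G = B p" by blast
    define \<phi> \<delta> where "\<phi> = fst p" and "\<delta> = snd p"
    have \<phi>: "\<phi> \<in> C" "G = {x\<in>D. \<phi> x \<le> \<delta>}" using p by (auto simp: B_def \<phi>_def \<delta>_def)
    have u': "u k \<in> D" "\<phi> (u k) \<le> \<delta>" for k using u[of k] \<phi>(2) by simp_all
    have "(\<lambda>k. \<phi> (u k)) \<longlonglongrightarrow> \<phi> l" by (rule cont[OF \<phi>(1) u'(1) l])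
    then have "\<phi> l \<le> \<delta>" using u'(2) by (intro LIMSEQ_le_const2) auto
    then show "l \<in> G" using l \<phi>(2) by simp
  next
    fix S assume S: "finite S" "S \<subseteq> B ` (C \<times> {0<..})"
    then obtain T where T: "finite T" "T \<subseteq> C \<times> {0<..}" "S = B ` T"
      by (meson finite_subset_image)
    show "D \<inter> \<Inter>S \<noteq> {}"
    proof (cases "T = {}")
      case True then show ?thesis using ne T(3) by simp
    next
      case False
      define \<delta> where "\<delta> = Min (snd ` T)"
      have "\<delta> \<in> snd ` T" unfolding \<delta>_def using False T(1) by (intro Min_in) auto
      then have \<delta>0: "0 < \<delta>" using T(2) by auto
      have \<delta>: "\<delta> \<le> snd p" if "p \<in> T" for p unfolding \<delta>_def using that T(1) by auto
      show ?thesis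
      proof (rule ccontr)
        assume "\<not> ?thesis"
        then have empty: "D \<inter> \<Inter>S = {}" by simp
        have max: "\<exists>\<phi>\<in>fst ` T. \<delta> \<le> \<phi> x" if x: "x \<in> D" for x
        proof -
          from x empty obtain G where "G \<in> S" "x \<notin> G" by blast
          then obtain p where p: "p \<in> T" "x \<notin> B p" using T(3) by blast
          then have "snd p < fst p x" using x unfolding B_def by simp
          with \<delta>[OF p(1)] have "\<delta> \<le> fst p x" by simp
          with p(1) show ?thesis by blast
        qed
        have T': "finite (fst ` T)" "fst ` T \<noteq> {}" "fst ` T \<subseteq> C" using T False by auto
        have "\<exists>\<phi>\<in>C. \<forall>x\<in>D. \<delta> \<le> \<phi> x"
          by (rule minimax_finite[of "fst ` T" C D mix \<delta>])
             (assumption | rule T' mix_closed aff conv max)+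
        then obtain \<phi> where \<phi>: "\<phi> \<in> C" "\<forall>x\<in>D. \<delta> \<le> \<phi> x" by blast
        from inf[OF \<phi>(1) \<delta>0] \<phi>(2) show False by force
      qed
    qed
  qed
  then obtain x where x: "x \<in> D" "\<forall>G\<in>B ` (C \<times> {0<..}). x \<in> G" by blast
  have le: "\<phi> x \<le> \<delta>" if "\<phi> \<in> C" "0 < \<delta>" for \<phi> \<delta>
  proof -
    have "B (\<phi>, \<delta>) \<in> B ` (C \<times> {0<..})" using that by (intro imageI) simp
    with x(2) have "x \<in> B (\<phi>, \<delta>)" by blast
    then show ?thesis by (simp add: B_def)
  qed
  have "\<phi> x \<le> 0" if "\<phi> \<in> C" for \<phi>
    by (rule field_le_epsilon) (simp add: le[OF that])
  with x(1) show ?thesis by blast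
qed

section \<open>Distances in \<open>L\<^sup>1\<close>\<close>

text \<open>Completeness of \<open>L\<^sup>1\<close> for sequences of functions: an almost everywhere convergent subsequence
provides the limit, and Fatou's lemma carries the Cauchy estimate over to it.\<close>

lemma L1_Cauchy_convergent:
  fixes s :: "nat \<Rightarrow> 'a \<Rightarrow> real"
  assumes int: "\<And>i. integrable M (s i)"
    and cauchy: "\<And>e. 0 < e \<Longrightarrow> \<exists>K. \<forall>i\<ge>K. \<forall>j\<ge>K. (LINT x|M. \<bar>s i x - s j x\<bar>) < e"
  shows "\<exists>f. integrable M f \<and> (\<lambda>i. LINT x|M. \<bar>s i x - f x\<bar>) \<longlonglongrightarrow> 0"
proof -
  note [measurable] = borel_measurable_integrable[OF int]
  obtain r :: "nat \<Rightarrow> nat" where r: "strict_mono r" "AE x in M. Cauchy (\<lambda>i. s (r i) x)"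
    using cauchy_L1_AE_cauchy_subseq[of M s, OF int] cauchy by auto
  define f where "f x = lim (\<lambda>i. s (r i) x)" for x
  have [measurable]: "f \<in> borel_measurable M"
    unfolding f_def by measurable
  have conv: "AE x in M. (\<lambda>j. s (r j) x) \<longlonglongrightarrow> f x"
    using r(2) by eventually_elim (simp add: f_def Cauchy_convergent_iff convergent_LIMSEQ_iff)
  have fatou: "(\<integral>\<^sup>+x. ennreal \<bar>s i x - f x\<bar> \<partial>M) \<le> ennreal e"
    if e: "0 < e" and K: "\<forall>i\<ge>K. \<forall>j\<ge>K. (LINT x|M. \<bar>s i x - s j x\<bar>) < e" and i: "K \<le> i" for e K i
  proof -
    have "(\<integral>\<^sup>+x. ennreal \<bar>s i x - f x\<bar> \<partial>M) = (\<integral>\<^sup>+x. liminf (\<lambda>j. ennreal \<bar>s i x - s (r j) x\<bar>) \<partial>M)"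
    proof (rule nn_integral_cong_AE)
      show "AE x in M. ennreal \<bar>s i x - f x\<bar> = liminf (\<lambda>j. ennreal \<bar>s i x - s (r j) x\<bar>)"
        using conv
      proof eventually_elim
        case (elim x)
        have "(\<lambda>j. ennreal \<bar>s i x - s (r j) x\<bar>) \<longlonglongrightarrow> ennreal \<bar>s i x - f x\<bar>"
          by (intro tendsto_intros elim)
        from lim_imp_Liminf[OF _ this] show ?case by simp
      qed
    qed
    also have "\<dots> \<le> liminf (\<lambda>j. \<integral>\<^sup>+x. ennreal \<bar>s i x - s (r j) x\<bar> \<partial>M)"
      by (rule nn_integral_liminf) measurable
    also have "\<dots> \<le> ennreal e"
    proof (rule Liminf_le)
      have "(\<integral>\<^sup>+x. ennreal \<bar>s i x - s (r j) x\<bar> \<partial>M) \<le> ennreal e" if "K \<le> j" for j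
      proof -
        have "K \<le> r j" using that seq_suble[OF r(1), of j] by simp
        moreover have "(\<integral>\<^sup>+x. ennreal \<bar>s i x - s (r j) x\<bar> \<partial>M) = ennreal (LINT x|M. \<bar>s i x - s (r j) x\<bar>)"
          by (intro nn_integral_eq_integral integrable_abs Bochner_Integration.integrable_diff int) simp
        ultimately show ?thesis using K i by (simp add: ennreal_leI less_imp_le)
      qed
      then show "\<forall>\<^sub>F j in sequentially. (\<integral>\<^sup>+x. ennreal \<bar>s i x - s (r j) x\<bar> \<partial>M) \<le> ennreal e"
        using eventually_sequentially by auto
    qed simp
    finally show ?thesis .
  qed
  have ex: "\<exists>K. \<forall>i\<ge>K. (\<integral>\<^sup>+x. ennreal \<bar>s i x - f x\<bar> \<partial>M) \<le> ennreal e" if e: "0 < e" for e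
    using cauchy[OF e] fatou[OF e] by blast
  have dint: "integrable M f"
  proof -
    obtain K where "(\<integral>\<^sup>+x. ennreal \<bar>s K x - f x\<bar> \<partial>M) \<le> ennreal 1" using ex[of 1] by auto
    then have "(\<integral>\<^sup>+x. ennreal \<bar>s K x - f x\<bar> \<partial>M) < \<infinity>" by (simp add: le_less_trans)
    then have "integrable M (\<lambda>x. s K x - f x)"
      by (intro integrableI_bounded) auto
    from Bochner_Integration.integrable_diff[OF int[of K] this] show ?thesis by simp
  qed
  have "(\<lambda>i. LINT x|M. \<bar>s i x - f x\<bar>) \<longlonglongrightarrow> 0"
  proof (rule LIMSEQ_I)
    fix e :: real assume "0 < e"
    then obtain K where K: "\<forall>i\<ge>K. (\<integral>\<^sup>+x. ennreal \<bar>s i x - f x\<bar> \<partial>M) \<le> ennreal (e/2)"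
      using ex[of "e/2"] by auto
    have "norm ((LINT x|M. \<bar>s i x - f x\<bar>) - 0) < e" if "K \<le> i" for i
    proof -
      have "ennreal (LINT x|M. \<bar>s i x - f x\<bar>) = (\<integral>\<^sup>+x. ennreal \<bar>s i x - f x\<bar> \<partial>M)"
        by (intro nn_integral_eq_integral[symmetric] integrable_abs Bochner_Integration.integrable_diff int dint) simp
      then have "ennreal (LINT x|M. \<bar>s i x - f x\<bar>) \<le> ennreal (e/2)" using K that by simp
      then have "(LINT x|M. \<bar>s i x - f x\<bar>) \<le> e/2" using \<open>0 < e\<close> by (simp add: ennreal_le_iff)
      moreover have "0 \<le> (LINT x|M. \<bar>s i x - f x\<bar>)" by simp
      ultimately show ?thesis using \<open>0 < e\<close> by simp
    qed
    then show "\<exists>K. \<forall>i\<ge>K. norm ((LINT x|M. \<bar>s i x - f x\<bar>) - 0) < e" by blast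
  qed
  with dint show ?thesis by blast
qed

text \<open>The convexity defect of \<open>\<lambda>x. exp (- x)\<close> at the midpoint is a square. This is what makes
\<open>exp (- x)\<close> a convenient strictly convex function on densities: it is moreover bounded there.\<close>

lemma exp_defect_eq_square:
  fixes a b :: real
  shows "(exp (- a) + exp (- b)) / 2 - exp (- ((a + b) / 2)) = (exp (- a / 2) - exp (- b / 2))\<^sup>2 / 2"
proof -
  have "exp (- a / 2) ^ 2 = exp (- a)" "exp (- b / 2) ^ 2 = exp (- b)"
    by (simp_all add: exp_double[symmetric])
  moreover have "exp (- a / 2) * exp (- b / 2) = exp (- ((a + b) / 2))"
    by (simp add: exp_add[symmetric] field_simps)
  ultimately show ?thesis by (simp add: power2_diff field_simps)
qed

text \<open>Below the level \<open>c\<close> the function \<open>\<lambda>x. exp (- x / 2)\<close> has slope at least \<open>exp (- c / 2) / 2\<close> in absolute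
value, so a difference of the truncated numbers is controlled by the square root of the defect;
the inequality \<open>2 * u \<le> e + u\<^sup>2 / e\<close> removes the root. What truncation at \<open>c\<close> loses is added.\<close>

lemma abs_diff_le_exp_defect:
  fixes a b c e :: real
  assumes "0 < e"
  shows "\<bar>a - b\<bar> \<le> e + (2 * exp c / e) * ((exp (- a) + exp (- b)) / 2 - exp (- ((a + b) / 2)))
           + max 0 (a - c) + max 0 (b - c)"
  using assms
proof (induction a b rule: linorder_wlog)
  case (sym a b)
  then show ?case by (simp add: abs_minus_commute add.commute[of b a] add.commute[of "exp (- b)"] )
next
  case (le a b)
  define w where "w = exp (- a / 2) - exp (- b / 2)"
  define E where "E = exp (c / 2)"
  have E: "0 < E" "E\<^sup>2 = exp c" by (simp_all add: E_def exp_double[symmetric])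
  have w0: "0 \<le> w" using le by (simp add: w_def)
  note w2 = exp_defect_eq_square[of a b, folded w_def]
  have trunc: "min b c - min a c \<le> 2 * E * w"
  proof (cases "a \<le> c")
    case True
    define m where "m = min b c"
    have "1 + (m - a) / 2 \<le> exp ((m - a) / 2)" by (rule exp_ge_add_one_self)
    then have "exp (- m / 2) * (1 + (m - a) / 2) \<le> exp (- m / 2) * exp ((m - a) / 2)" by simp
    also have "\<dots> = exp (- a / 2)" by (simp add: exp_add[symmetric] field_simps)
    finally have "exp (- m / 2) * ((m - a) / 2) \<le> exp (- a / 2) - exp (- m / 2)"
      by (simp add: algebra_simps)
    also have "\<dots> \<le> w" by (simp add: w_def m_def)
    finally have 1: "exp (- m / 2) * ((m - a) / 2) \<le> w" .
    have "exp (- c / 2) * ((m - a) / 2) \<le> exp (- m / 2) * ((m - a) / 2)"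
      using True le by (intro mult_right_mono) (auto simp: m_def)
    with 1 have "exp (- c / 2) * ((m - a) / 2) \<le> w" by simp
    then have "E * (exp (- c / 2) * ((m - a) / 2)) \<le> E * w" using E by simp
    moreover have "E * exp (- c / 2) = 1" by (simp add: E_def exp_add[symmetric])
    ultimately have "(m - a) / 2 \<le> E * w" by (simp add: mult.assoc[symmetric])
    then show ?thesis using True by (simp add: m_def)
  next
    case False
    then show ?thesis using le E w0 by simp
  qed
  \<comment> \<open>This is \<open>2 * u \<le> e + u\<^sup>2 / e\<close> for \<open>u = E * w\<close>.\<close>
  have "0 \<le> (E * w - e)\<^sup>2" by simp
  then have "2 * E * w * e \<le> e * e + E\<^sup>2 * w\<^sup>2" by (simp add: power2_diff power_mult_distrib power2_eq_square algebra_simps)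
  then have "2 * E * w \<le> (e * e + E\<^sup>2 * w\<^sup>2) / e" using \<open>0 < e\<close> by (simp add: pos_le_divide_eq)
  also have "\<dots> = e + (2 * exp c / e) * (w\<^sup>2 / 2)" using \<open>0 < e\<close> E by (simp add: field_simps)
  finally have "min b c - min a c \<le> e + (2 * exp c / e) * (w\<^sup>2 / 2)" using trunc by simp
  moreover have "\<bar>a - b\<bar> \<le> (min b c - min a c) + max 0 (a - c) + max 0 (b - c)" using le by auto
  ultimately show ?case unfolding w2 by linarith
qed

section \<open>The spaces \<open>L\<^sub>s\<^sup>1\<close>\<close>

text \<open>Uniform integrability in terms of the excess \<open>(Z - c)\<^sup>+\<close> instead of \<open>Z * I(Z > c)\<close>: the excess is at most
\<open>Z * I(Z > c)\<close>, while \<open>Z * I(Z > k)\<close> is at most twice the excess over \<open>c\<close> once \<open>k \<ge> 2 * c\<close>. The excess is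
better behaved under sums and multiples. Families of random variables on a fixed space and a fixed
random variable under a family of measures are both covered.\<close>

lemma uniform_tail_iff:
  fixes Z :: "'i \<Rightarrow> 'a \<Rightarrow> real" and \<mu> :: "'i \<Rightarrow> 'a measure"
  assumes meas: "\<And>i. i \<in> I \<Longrightarrow> Z i \<in> borel_measurable (\<mu> i)"
  shows "((\<lambda>k::real. SUP i\<in>I. \<integral>\<^sup>+\<omega>. ennreal (Z i \<omega>) * indicator {\<omega>. Z i \<omega> > k} \<omega> \<partial>\<mu> i) \<longlongrightarrow> 0) at_top
    \<longleftrightarrow> (\<forall>e>0. \<exists>c>0. \<forall>i\<in>I. (\<integral>\<^sup>+\<omega>. ennreal (Z i \<omega> - c) \<partial>\<mu> i) \<le> ennreal e)"
    (is "(?S \<longlongrightarrow> 0) at_top \<longleftrightarrow> ?R")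
proof
  assume lim: "(?S \<longlongrightarrow> 0) at_top"
  show ?R
  proof (intro allI impI)
    fix e :: real assume "0 < e"
    then have "\<forall>\<^sub>F k in at_top. ?S k < ennreal e" using order_tendstoD(2)[OF lim, of "ennreal e"] by simp
    then have "\<forall>\<^sub>F k in at_top. ?S k < ennreal e \<and> 0 < k" using eventually_gt_at_top[of "0::real"]
      by (rule eventually_conj)
    from eventually_happens'[OF _ this] obtain k where k: "?S k < ennreal e" "0 < k" by auto
    have "(\<integral>\<^sup>+\<omega>. ennreal (Z i \<omega> - k) \<partial>\<mu> i) \<le> ennreal e" if "i \<in> I" for i
    proof -
      have "(\<integral>\<^sup>+\<omega>. ennreal (Z i \<omega> - k) \<partial>\<mu> i)
          \<le> (\<integral>\<^sup>+\<omega>. ennreal (Z i \<omega>) * indicator {\<omega>. Z i \<omega> > k} \<omega> \<partial>\<mu> i)"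
        using k(2) by (intro nn_integral_mono) (auto simp: indicator_def ennreal_neg intro!: ennreal_leI)
      also have "\<dots> \<le> ?S k" using that by (rule SUP_upper)
      finally show ?thesis using k(1) by simp
    qed
    with k(2) show "\<exists>c>0. \<forall>i\<in>I. (\<integral>\<^sup>+\<omega>. ennreal (Z i \<omega> - c) \<partial>\<mu> i) \<le> ennreal e" by blast
  qed
next
  assume R: ?R
  show "(?S \<longlongrightarrow> 0) at_top"
  proof (rule order_tendstoI)
    fix e :: ennreal assume "0 < e"
    then obtain d where d: "0 < d" "d < e" using dense by blast
    from d(2) have "d < top" by (rule less_le_trans) simp
    define r where "r = enn2real d"
    have r: "ennreal r = d" using \<open>d < top\<close> by (simp add: r_def)
    then have r0: "0 < r" using d(1) by (metis ennreal_less_zero_iff)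
    then have "0 < r / 2" by simp
    with R obtain c where c: "0 < c" "\<forall>i\<in>I. (\<integral>\<^sup>+\<omega>. ennreal (Z i \<omega> - c) \<partial>\<mu> i) \<le> ennreal (r / 2)"
      by blast
    have "?S k < e" if k: "2 * c \<le> k" for k
    proof -
      have "?S k \<le> ennreal r"
      proof (rule SUP_least)
        fix i assume i: "i \<in> I"
        note [measurable] = meas[OF i]
        have "ennreal (Z i \<omega>) * indicator {\<omega>. Z i \<omega> > k} \<omega> \<le> 2 * ennreal (Z i \<omega> - c)" for \<omega>
        proof (cases "Z i \<omega> > k")
          case True
          then have "ennreal (Z i \<omega>) \<le> ennreal (2 * (Z i \<omega> - c))" using k by (intro ennreal_leI) simp
          also have "\<dots> = 2 * ennreal (Z i \<omega> - c)" using True k c(1) by (subst ennreal_mult) auto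
          finally show ?thesis using True by simp
        qed simp
        then have "(\<integral>\<^sup>+\<omega>. ennreal (Z i \<omega>) * indicator {\<omega>. Z i \<omega> > k} \<omega> \<partial>\<mu> i)
            \<le> (\<integral>\<^sup>+\<omega>. 2 * ennreal (Z i \<omega> - c) \<partial>\<mu> i)" by (intro nn_integral_mono)
        also have "\<dots> = 2 * (\<integral>\<^sup>+\<omega>. ennreal (Z i \<omega> - c) \<partial>\<mu> i)" by (rule nn_integral_cmult) measurable
        also have "\<dots> \<le> 2 * ennreal (r / 2)" using c(2) i by (intro mult_left_mono) auto
        also have "\<dots> = ennreal (2 * (r / 2))" using r0 by (subst ennreal_mult) auto
        finally show "(\<integral>\<^sup>+\<omega>. ennreal (Z i \<omega>) * indicator {\<omega>. Z i \<omega> > k} \<omega> \<partial>\<mu> i) \<le> ennreal r" by simp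
      qed
      then show ?thesis using r d(2) by simp
    qed
    then show "\<forall>\<^sub>F k in at_top. ?S k < e" by (rule eventually_at_top_linorderI)
  qed simp
qed

lemma measurable_ac_measures:
  assumes "W \<subseteq> ac_measures M" "Q \<in> W" "X \<in> borel_measurable M"
  shows "X \<in> borel_measurable Q"
proof -
  have "sets Q = sets M" using assms(1,2) by (auto simp: ac_measures_def)
  from measurable_cong_sets[OF this refl] assms(3) show ?thesis by blast
qed

lemma L1s_iff:
  assumes W: "W \<subseteq> ac_measures M"
  shows "X \<in> L1s M W \<longleftrightarrow> X \<in> borel_measurable M \<and>
    (\<forall>e>0. \<exists>c>0. \<forall>Q\<in>W. (\<integral>\<^sup>+\<omega>. ennreal (\<bar>X \<omega>\<bar> - c) \<partial>Q) \<le> ennreal e)"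
proof -
  have "(\<lambda>\<omega>. \<bar>X \<omega>\<bar>) \<in> borel_measurable Q" if X: "X \<in> borel_measurable M" and Q: "Q \<in> W" for Q
    using measurable_ac_measures[OF W Q X] by measurable
  from uniform_tail_iff[of W "\<lambda>_ \<omega>. \<bar>X \<omega>\<bar>" "\<lambda>Q. Q", OF this] show ?thesis
    by (auto simp: L1s_def)
qed

lemma L1s_add:
  assumes W: "W \<subseteq> ac_measures M" and X: "X \<in> L1s M W" and Y: "Y \<in> L1s M W"
  shows "(\<lambda>\<omega>. X \<omega> + Y \<omega>) \<in> L1s M W"
proof -
  have [measurable]: "X \<in> borel_measurable M" "Y \<in> borel_measurable M"
    using X Y by (auto simp: L1s_def)
  have "\<exists>c>0. \<forall>Q\<in>W. (\<integral>\<^sup>+\<omega>. ennreal (\<bar>X \<omega> + Y \<omega>\<bar> - c) \<partial>Q) \<le> ennreal e" if e: "0 < e" for e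
  proof -
    have e2: "0 < e / 2" using e by simp
    obtain a where a: "0 < a" "\<forall>Q\<in>W. (\<integral>\<^sup>+\<omega>. ennreal (\<bar>X \<omega>\<bar> - a) \<partial>Q) \<le> ennreal (e / 2)"
      using X e2 unfolding L1s_iff[OF W] by blast
    obtain b where b: "0 < b" "\<forall>Q\<in>W. (\<integral>\<^sup>+\<omega>. ennreal (\<bar>Y \<omega>\<bar> - b) \<partial>Q) \<le> ennreal (e / 2)"
      using Y e2 unfolding L1s_iff[OF W] by blast
    have "(\<integral>\<^sup>+\<omega>. ennreal (\<bar>X \<omega> + Y \<omega>\<bar> - (a + b)) \<partial>Q) \<le> ennreal e" if Q: "Q \<in> W" for Q
    proof -
      have [measurable]: "X \<in> borel_measurable Q" "Y \<in> borel_measurable Q"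
        by (auto intro: measurable_ac_measures[OF W Q])
      have "ennreal (\<bar>X \<omega> + Y \<omega>\<bar> - (a + b)) \<le> ennreal (\<bar>X \<omega>\<bar> - a) + ennreal (\<bar>Y \<omega>\<bar> - b)" for \<omega>
      proof -
        have "ennreal (\<bar>X \<omega> + Y \<omega>\<bar> - (a + b)) \<le> ennreal (max 0 (\<bar>X \<omega>\<bar> - a) + max 0 (\<bar>Y \<omega>\<bar> - b))"
          by (intro ennreal_leI) linarith
        also have "\<dots> = ennreal (\<bar>X \<omega>\<bar> - a) + ennreal (\<bar>Y \<omega>\<bar> - b)"
          by (subst ennreal_plus) simp_all
        finally show ?thesis .
      qed
      then have "(\<integral>\<^sup>+\<omega>. ennreal (\<bar>X \<omega> + Y \<omega>\<bar> - (a + b)) \<partial>Q)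
          \<le> (\<integral>\<^sup>+\<omega>. ennreal (\<bar>X \<omega>\<bar> - a) + ennreal (\<bar>Y \<omega>\<bar> - b) \<partial>Q)" by (intro nn_integral_mono)
      also have "\<dots> = (\<integral>\<^sup>+\<omega>. ennreal (\<bar>X \<omega>\<bar> - a) \<partial>Q) + (\<integral>\<^sup>+\<omega>. ennreal (\<bar>Y \<omega>\<bar> - b) \<partial>Q)"
        by (rule nn_integral_add) measurable
      also have "\<dots> \<le> ennreal (e / 2) + ennreal (e / 2)" using a(2) b(2) Q by (intro add_mono) auto
      also have "\<dots> = ennreal e" using e by (simp flip: ennreal_plus)
      finally show ?thesis .
    qed
    moreover have "0 < a + b" using a(1) b(1) by simp
    ultimately show ?thesis by blast
  qed
  moreover have "(\<lambda>\<omega>. X \<omega> + Y \<omega>) \<in> borel_measurable M" by measurable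
  ultimately show ?thesis unfolding L1s_iff[OF W] by blast
qed

lemma L1s_cmult:
  assumes W: "W \<subseteq> ac_measures M" and X: "X \<in> L1s M W"
  shows "(\<lambda>\<omega>. t * X \<omega>) \<in> L1s M W"
proof -
  define s where "s = \<bar>t\<bar> + 1"
  have s: "0 < s" "\<bar>t\<bar> \<le> s" by (simp_all add: s_def)
  have [measurable]: "X \<in> borel_measurable M" using X by (auto simp: L1s_def)
  have "\<exists>c>0. \<forall>Q\<in>W. (\<integral>\<^sup>+\<omega>. ennreal (\<bar>t * X \<omega>\<bar> - c) \<partial>Q) \<le> ennreal e" if e: "0 < e" for e
  proof -
    have "0 < e / s" using e s by simp
    then obtain a where a: "0 < a" "\<forall>Q\<in>W. (\<integral>\<^sup>+\<omega>. ennreal (\<bar>X \<omega>\<bar> - a) \<partial>Q) \<le> ennreal (e / s)"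
      using X unfolding L1s_iff[OF W] by blast
    have "(\<integral>\<^sup>+\<omega>. ennreal (\<bar>t * X \<omega>\<bar> - s * a) \<partial>Q) \<le> ennreal e" if Q: "Q \<in> W" for Q
    proof -
      have [measurable]: "X \<in> borel_measurable Q"
        by (auto intro: measurable_ac_measures[OF W Q])
      have "ennreal (\<bar>t * X \<omega>\<bar> - s * a) \<le> ennreal s * ennreal (\<bar>X \<omega>\<bar> - a)" for \<omega>
      proof -
        have "\<bar>t\<bar> * \<bar>X \<omega>\<bar> \<le> s * \<bar>X \<omega>\<bar>" using s by (intro mult_right_mono) auto
        then have "ennreal (\<bar>t * X \<omega>\<bar> - s * a) \<le> ennreal (s * (\<bar>X \<omega>\<bar> - a))"
          by (intro ennreal_leI) (simp add: abs_mult algebra_simps)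
        also have "\<dots> = ennreal s * ennreal (\<bar>X \<omega>\<bar> - a)" using s by (simp add: ennreal_mult')
        finally show ?thesis .
      qed
      then have "(\<integral>\<^sup>+\<omega>. ennreal (\<bar>t * X \<omega>\<bar> - s * a) \<partial>Q)
          \<le> (\<integral>\<^sup>+\<omega>. ennreal s * ennreal (\<bar>X \<omega>\<bar> - a) \<partial>Q)" by (intro nn_integral_mono)
      also have "\<dots> = ennreal s * (\<integral>\<^sup>+\<omega>. ennreal (\<bar>X \<omega>\<bar> - a) \<partial>Q)"
        by (rule nn_integral_cmult) measurable
      also have "\<dots> \<le> ennreal s * ennreal (e / s)" using a(2) Q by (intro mult_left_mono) auto
      also have "\<dots> = ennreal e" using e s by (simp flip: ennreal_mult)
      finally show ?thesis .
    qed
    moreover have "0 < s * a" using a(1) s by simp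
    ultimately show ?thesis by blast
  qed
  moreover have "(\<lambda>\<omega>. t * X \<omega>) \<in> borel_measurable M" by measurable
  ultimately show ?thesis unfolding L1s_iff[OF W] by blast
qed

lemma L1s_bounded:
  assumes W: "W \<subseteq> ac_measures M" and X: "X \<in> borel_measurable M" and b: "\<And>\<omega>. \<bar>X \<omega>\<bar> \<le> b"
  shows "X \<in> L1s M W"
proof -
  have "(\<integral>\<^sup>+\<omega>. ennreal (\<bar>X \<omega>\<bar> - (\<bar>b\<bar> + 1)) \<partial>Q) \<le> ennreal e" for Q :: "'a measure" and e
  proof -
    have "ennreal (\<bar>X \<omega>\<bar> - (\<bar>b\<bar> + 1)) = 0" for \<omega> using b[of \<omega>] by (intro ennreal_neg) linarith
    then show ?thesis by simp
  qed
  moreover have "0 < \<bar>b\<bar> + 1" by simp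
  ultimately show ?thesis unfolding L1s_iff[OF W] using X by blast
qed

text \<open>The integral of \<open>\<bar>X\<bar>\<close> exceeds that of the excess over \<open>a\<close> by at most \<open>a\<close>.\<close>

lemma L1s_nn_integral_bound:
  assumes W: "W \<subseteq> ac_measures M" and X: "X \<in> L1s M W"
  shows "\<exists>b. \<forall>Q\<in>W. (\<integral>\<^sup>+\<omega>. ennreal \<bar>X \<omega>\<bar> \<partial>Q) \<le> ennreal b"
proof -
  have "\<forall>e>0. \<exists>c>0. \<forall>Q\<in>W. (\<integral>\<^sup>+\<omega>. ennreal (\<bar>X \<omega>\<bar> - c) \<partial>Q) \<le> ennreal e"
    using X unfolding L1s_iff[OF W] by blast
  from this[rule_format, OF zero_less_one] obtain a where
    a: "0 < a" "\<forall>Q\<in>W. (\<integral>\<^sup>+\<omega>. ennreal (\<bar>X \<omega>\<bar> - a) \<partial>Q) \<le> ennreal 1" by blast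
  have Xm: "X \<in> borel_measurable M" using X by (auto simp: L1s_def)
  have "(\<integral>\<^sup>+\<omega>. ennreal \<bar>X \<omega>\<bar> \<partial>Q) \<le> ennreal (1 + a)" if Q: "Q \<in> W" for Q
  proof -
    have [measurable]: "X \<in> borel_measurable Q" by (rule measurable_ac_measures[OF W Q Xm])
    interpret Q: prob_space Q using W Q by (auto simp: ac_measures_def)
    have "ennreal \<bar>X \<omega>\<bar> \<le> ennreal (\<bar>X \<omega>\<bar> - a) + ennreal a" for \<omega>
    proof -
      have "ennreal \<bar>X \<omega>\<bar> \<le> ennreal (max 0 (\<bar>X \<omega>\<bar> - a) + a)" by (intro ennreal_leI) linarith
      also have "\<dots> = ennreal (\<bar>X \<omega>\<bar> - a) + ennreal a"
        using a(1) by (subst ennreal_plus) simp_all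
      finally show ?thesis .
    qed
    then have "(\<integral>\<^sup>+\<omega>. ennreal \<bar>X \<omega>\<bar> \<partial>Q) \<le> (\<integral>\<^sup>+\<omega>. ennreal (\<bar>X \<omega>\<bar> - a) + ennreal a \<partial>Q)"
      by (intro nn_integral_mono)
    also have "\<dots> = (\<integral>\<^sup>+\<omega>. ennreal (\<bar>X \<omega>\<bar> - a) \<partial>Q) + ennreal a"
      by (subst nn_integral_add) (auto simp: Q.emeasure_space_1)
    also have "\<dots> \<le> ennreal 1 + ennreal a" using a(2) Q by (intro add_right_mono) auto
    also have "\<dots> = ennreal (1 + a)" using a(1) by (subst ennreal_plus) simp_all
    finally show ?thesis .
  qed
  then show ?thesis by blast
qed

lemma L1s_integrable:
  assumes W: "W \<subseteq> ac_measures M" and X: "X \<in> L1s M W" and Q: "Q \<in> W"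
  shows "integrable Q X"
proof -
  obtain b where "(\<integral>\<^sup>+\<omega>. ennreal \<bar>X \<omega>\<bar> \<partial>Q) \<le> ennreal b" using L1s_nn_integral_bound[OF W X] Q by blast
  moreover have "X \<in> borel_measurable Q" using measurable_ac_measures[OF W Q] X by (auto simp: L1s_def)
  ultimately show ?thesis by (intro integrableI_bounded) (auto intro: le_less_trans)
qed

lemma expect_eq_integral:
  assumes "integrable Q X"
  shows "expect Q X = ereal (integral\<^sup>L Q X)"
proof -
  have p: "integrable Q (\<lambda>\<omega>. max 0 (X \<omega>))" and m: "integrable Q (\<lambda>\<omega>. max 0 (- X \<omega>))"
    using assms by (auto intro!: integrable_max)
  have "integral\<^sup>L Q X = (\<integral>\<omega>. max 0 (X \<omega>) - max 0 (- X \<omega>) \<partial>Q)"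
    by (intro Bochner_Integration.integral_cong) auto
  also have "\<dots> = (\<integral>\<omega>. max 0 (X \<omega>) \<partial>Q) - (\<integral>\<omega>. max 0 (- X \<omega>) \<partial>Q)"
    by (rule Bochner_Integration.integral_diff[OF p m])
  finally show ?thesis
    unfolding expect_def using nn_integral_eq_integral[OF p] nn_integral_eq_integral[OF m]
    by (simp add: Let_def enn2ereal_ennreal)
qed

section \<open>Densities of a set of measures\<close>

text \<open>Versions of the densities of the measures in \<open>W\<close>, on which convex combinations can be formed
pointwise. Nonnegativity everywhere rather than almost everywhere keeps \<open>exp (- f)\<close> between 0 and 1
at every point.\<close>

definition densities :: "'a measure \<Rightarrow> 'a measure set \<Rightarrow> ('a \<Rightarrow> real) set" where
  "densities M W = {f \<in> borel_measurable M. (\<forall>\<omega>. 0 \<le> f \<omega>) \<and> density M (\<lambda>\<omega>. ennreal (f \<omega>)) \<in> W}"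

lemma densitiesD:
  assumes "f \<in> densities M W"
  shows "f \<in> borel_measurable M" "0 \<le> f \<omega>" "density M (\<lambda>\<omega>. ennreal (f \<omega>)) \<in> W"
  using assms by (auto simp: densities_def)

lemma density_integrable:
  assumes W: "W \<subseteq> ac_measures M" and f: "f \<in> densities M W"
  shows "integrable M f"
proof -
  have [measurable]: "f \<in> borel_measurable M" by (rule densitiesD[OF f])
  interpret Q: prob_space "density M (\<lambda>\<omega>. ennreal (f \<omega>))"
    using W densitiesD(3)[OF f] by (auto simp: ac_measures_def)
  have "(\<integral>\<^sup>+\<omega>. ennreal (f \<omega>) \<partial>M) = emeasure (density M (\<lambda>\<omega>. ennreal (f \<omega>))) (space M)"
    by (subst emeasure_density) (auto intro!: nn_integral_cong)
  also have "\<dots> = 1" using Q.emeasure_space_1 by simp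
  finally have 1: "(\<integral>\<^sup>+\<omega>. ennreal (f \<omega>) \<partial>M) = ennreal 1" by simp
  show ?thesis using 1 densitiesD(2)[OF f] by (intro integrableI_nn_integral_finite[of _ _ 1]) auto
qed

context prob_space
begin

lemma dens_in_densities:
  assumes W: "W \<subseteq> ac_measures M" and Q: "Q \<in> W"
  shows "dens M Q \<in> densities M W" "density M (\<lambda>\<omega>. ennreal (dens M Q \<omega>)) = Q"
proof -
  have Q': "prob_space Q" "sets Q = sets M" "absolutely_continuous M Q"
    using W Q by (auto simp: ac_measures_def)
  interpret Q: prob_space Q by (rule Q')
  have "AE \<omega> in M. RN_deriv M Q \<omega> \<noteq> \<infinity>"
    by (rule RN_deriv_finite) (use Q' in \<open>auto intro: Q.sigma_finite_measure_axioms\<close>)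
  then have "density M (\<lambda>\<omega>. ennreal (dens M Q \<omega>)) = density M (RN_deriv M Q)"
    by (intro density_cong) (auto simp: dens_def[abs_def] less_top)
  also have "\<dots> = Q" by (rule density_RN_deriv) (use Q' in auto)
  finally show eq: "density M (\<lambda>\<omega>. ennreal (dens M Q \<omega>)) = Q" .
  show "dens M Q \<in> densities M W"
    unfolding densities_def using eq Q by (auto simp: dens_def[abs_def])
qed

lemma dens_density:
  assumes "f \<in> borel_measurable M" "\<And>\<omega>. 0 \<le> f \<omega>"
  shows "AE \<omega> in M. dens M (density M (\<lambda>\<omega>. ennreal (f \<omega>))) \<omega> = f \<omega>"
proof -
  have "AE \<omega> in M. ennreal (f \<omega>) = RN_deriv M (density M (\<lambda>\<omega>. ennreal (f \<omega>))) \<omega>"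
    by (rule RN_deriv_unique) (use assms in auto)
  then show ?thesis
  proof eventually_elim
    case (elim \<omega>)
    have "dens M (density M (\<lambda>\<omega>. ennreal (f \<omega>))) \<omega> = enn2real (ennreal (f \<omega>))"
      unfolding dens_def elim ..
    then show ?case using assms(2) by simp
  qed
qed

lemma densities_convex:
  assumes W: "W \<subseteq> ac_measures M" and conv: "convex_measures M W"
    and f: "f \<in> densities M W" and g: "g \<in> densities M W" and t: "t \<in> {0..1}"
  shows "(\<lambda>\<omega>. t * f \<omega> + (1 - t) * g \<omega>) \<in> densities M W"
proof -
  let ?d = "\<lambda>f. density M (\<lambda>\<omega>. ennreal (f \<omega>))"
  let ?h = "\<lambda>\<omega>. t * f \<omega> + (1 - t) * g \<omega>"
  note [measurable] = densitiesD(1)[OF f] densitiesD(1)[OF g]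
  have nn: "0 \<le> f \<omega>" "0 \<le> g \<omega>" for \<omega> using densitiesD(2)[OF f] densitiesD(2)[OF g] by auto
  obtain Q where Q: "Q \<in> W" "\<forall>E\<in>sets M. measure Q E = t * measure (?d f) E + (1 - t) * measure (?d g) E"
    using conv densitiesD(3)[OF f] densitiesD(3)[OF g] t unfolding convex_measures_def by blast
  have ac: "prob_space (?d f)" "prob_space (?d g)" "prob_space Q" "sets Q = sets M"
    using W Q(1) densitiesD(3)[OF f] densitiesD(3)[OF g] by (auto simp: ac_measures_def)
  have "?d ?h = Q"
  proof (rule measure_eqI)
    show "sets (?d ?h) = sets Q" using ac(4) by simp
    fix E assume "E \<in> sets (?d ?h)"
    then have E[measurable]: "E \<in> sets M" by simp
    have "emeasure (?d ?h) E = (\<integral>\<^sup>+\<omega>. ennreal t * (ennreal (f \<omega>) * indicator E \<omega>)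
        + ennreal (1 - t) * (ennreal (g \<omega>) * indicator E \<omega>) \<partial>M)"
      using t nn by (subst emeasure_density)
        (auto intro!: nn_integral_cong simp: ennreal_plus ennreal_mult distrib_right mult.assoc)
    also have "\<dots> = ennreal t * emeasure (?d f) E + ennreal (1 - t) * emeasure (?d g) E"
      by (simp add: nn_integral_add nn_integral_cmult emeasure_density)
    also have "\<dots> = ennreal t * ennreal (measure (?d f) E) + ennreal (1 - t) * ennreal (measure (?d g) E)"
      using ac by (simp add: finite_measure.emeasure_eq_measure prob_space.finite_measure)
    also have "\<dots> = ennreal (measure Q E)"
      using Q(2) E t by (simp add: ennreal_plus ennreal_mult)
    also have "\<dots> = emeasure Q E"
      using ac by (simp add: finite_measure.emeasure_eq_measure prob_space.finite_measure)
    finally show "emeasure (?d ?h) E = emeasure Q E" .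
  qed
  then show ?thesis using Q(1) t nn by (auto simp: densities_def)
qed

text \<open>The hypothesis of closedness speaks of Radon-Nikodym derivatives. They agree almost everywhere with
the given versions, and the limit may be taken to be one of them.\<close>

lemma densities_L1_complete:
  assumes W: "W \<subseteq> ac_measures M" and closed: "L1_closed M W"
    and u: "\<And>k::nat. u k \<in> densities M W"
    and cauchy: "\<And>e. 0 < e \<Longrightarrow> \<exists>K. \<forall>i\<ge>K. \<forall>j\<ge>K. (LINT \<omega>|M. \<bar>u i \<omega> - u j \<omega>\<bar>) < e"
  shows "\<exists>g\<in>densities M W. (\<lambda>k. LINT \<omega>|M. \<bar>u k \<omega> - g \<omega>\<bar>) \<longlonglongrightarrow> 0"
proof -
  obtain f where f: "integrable M f" "(\<lambda>k. LINT \<omega>|M. \<bar>u k \<omega> - f \<omega>\<bar>) \<longlonglongrightarrow> 0"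
    using L1_Cauchy_convergent[of M u] density_integrable[OF W u] cauchy by blast
  note [measurable] = borel_measurable_integrable[OF f(1)] densitiesD(1)[OF u]
  have [measurable]: "dens M R \<in> borel_measurable M" for R by (simp add: dens_def[abs_def])
  define Q where "Q k = density M (\<lambda>\<omega>. ennreal (u k \<omega>))" for k
  have "(LINT \<omega>|M. \<bar>dens M (Q k) \<omega> - f \<omega>\<bar>) = (LINT \<omega>|M. \<bar>u k \<omega> - f \<omega>\<bar>)" for k
    using dens_density[of "u k", OF densitiesD(1,2)[OF u]]
    by (intro integral_cong_AE) (auto simp: Q_def)
  with f(2) have "(\<lambda>k. LINT \<omega>|M. \<bar>dens M (Q k) \<omega> - f \<omega>\<bar>) \<longlonglongrightarrow> 0" by simp
  moreover have "\<forall>k. Q k \<in> W" using densitiesD(3)[OF u] by (simp add: Q_def)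
  ultimately obtain R where R: "R \<in> W" "AE \<omega> in M. dens M R \<omega> = f \<omega>"
    using closed f(1) unfolding L1_closed_def by blast
  have "(LINT \<omega>|M. \<bar>u k \<omega> - dens M R \<omega>\<bar>) = (LINT \<omega>|M. \<bar>u k \<omega> - f \<omega>\<bar>)" for k
    using R(2) by (intro integral_cong_AE) auto
  with f(2) have "(\<lambda>k. LINT \<omega>|M. \<bar>u k \<omega> - dens M R \<omega>\<bar>) \<longlonglongrightarrow> 0" by simp
  then show ?thesis using dens_in_densities(1)[OF W R(1)] by blast
qed

text \<open>The uniform bound holds for the Radon-Nikodym derivatives by assumption, and each density is almost
everywhere equal to one of them.\<close>

lemma densities_uniform_tail:
  assumes W: "W \<subseteq> ac_measures M" and ui: "uniformly_integrable_measures M W" and e: "0 < e"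
  shows "\<exists>c>0. \<forall>f\<in>densities M W. (LINT \<omega>|M. max 0 (f \<omega> - c)) \<le> e"
proof -
  have dm: "dens M Q \<in> borel_measurable M" for Q by (simp add: dens_def[abs_def])
  from uniform_tail_iff[of W "dens M" "\<lambda>_. M", OF dm] ui
  have "\<forall>e>0. \<exists>c>0. \<forall>Q\<in>W. (\<integral>\<^sup>+\<omega>. ennreal (dens M Q \<omega> - c) \<partial>M) \<le> ennreal e"
    unfolding uniformly_integrable_measures_def by blast
  then obtain c where c: "0 < c" "\<forall>Q\<in>W. (\<integral>\<^sup>+\<omega>. ennreal (dens M Q \<omega> - c) \<partial>M) \<le> ennreal e"
    using e by blast
  have "(LINT \<omega>|M. max 0 (f \<omega> - c)) \<le> e" if f: "f \<in> densities M W" for f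
  proof -
    note [measurable] = densitiesD(1)[OF f]
    have "(\<integral>\<^sup>+\<omega>. ennreal (max 0 (f \<omega> - c)) \<partial>M)
        = (\<integral>\<^sup>+\<omega>. ennreal (dens M (density M (\<lambda>\<omega>. ennreal (f \<omega>))) \<omega> - c) \<partial>M)"
      using dens_density[OF densitiesD(1,2)[OF f]] by (intro nn_integral_cong_AE) auto
    also have "\<dots> \<le> ennreal e" using c(2) densitiesD(3)[OF f] by blast
    finally have 1: "(\<integral>\<^sup>+\<omega>. ennreal (max 0 (f \<omega> - c)) \<partial>M) \<le> ennreal e" .
    have "(LINT \<omega>|M. max 0 (f \<omega> - c)) = enn2real (\<integral>\<^sup>+\<omega>. ennreal (max 0 (f \<omega> - c)) \<partial>M)"
      by (rule integral_eq_nn_integral) auto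
    also have "\<dots> \<le> e" using 1 e by (intro enn2real_leI) auto
    finally show ?thesis .
  qed
  then show ?thesis using c(1) by blast
qed

lemma L1_dist_le_defect:
  assumes W: "W \<subseteq> ac_measures M" and f: "f \<in> densities M W" and g: "g \<in> densities M W" and e: "0 < e"
  shows "(LINT \<omega>|M. \<bar>f \<omega> - g \<omega>\<bar>) \<le> e
    + (2 * exp c / e) * (((LINT \<omega>|M. exp (- f \<omega>)) + (LINT \<omega>|M. exp (- g \<omega>))) / 2
        - (LINT \<omega>|M. exp (- ((f \<omega> + g \<omega>) / 2))))
    + (LINT \<omega>|M. max 0 (f \<omega> - c)) + (LINT \<omega>|M. max 0 (g \<omega> - c))"
proof -
  note [measurable] = densitiesD(1)[OF f] densitiesD(1)[OF g]
  note [simp] = densitiesD(2)[OF f] densitiesD(2)[OF g]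
  have [simp]: "integrable M f" "integrable M g" using density_integrable[OF W] f g by auto
  have [simp]: "integrable M (\<lambda>\<omega>. exp (- f \<omega>))" "integrable M (\<lambda>\<omega>. exp (- g \<omega>))"
      "integrable M (\<lambda>\<omega>. exp (- ((f \<omega> + g \<omega>) / 2)))"
    by (auto intro!: integrable_const_bound[of _ 1])
  have [simp]: "integrable M (\<lambda>\<omega>. max 0 (f \<omega> - c))" "integrable M (\<lambda>\<omega>. max 0 (g \<omega> - c))"
    by (auto intro!: integrable_max)
  have "(LINT \<omega>|M. \<bar>f \<omega> - g \<omega>\<bar>) \<le> (LINT \<omega>|M. e
      + (2 * exp c / e) * ((exp (- f \<omega>) + exp (- g \<omega>)) / 2 - exp (- ((f \<omega> + g \<omega>) / 2)))
      + max 0 (f \<omega> - c) + max 0 (g \<omega> - c))"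
    by (intro integral_mono abs_diff_le_exp_defect e) auto
  also have "\<dots> = e
    + (2 * exp c / e) * (((LINT \<omega>|M. exp (- f \<omega>)) + (LINT \<omega>|M. exp (- g \<omega>))) / 2
        - (LINT \<omega>|M. exp (- ((f \<omega> + g \<omega>) / 2))))
    + (LINT \<omega>|M. max 0 (f \<omega> - c)) + (LINT \<omega>|M. max 0 (g \<omega> - c))"
    by (simp add: prob_space)
  finally show ?thesis .
qed

text \<open>On a uniformly integrable set of densities, \<open>\<lambda>f. E exp (- f)\<close> is uniformly convex for the \<open>L\<^sup>1\<close> distance:
the level \<open>c\<close> that makes the tails small is the same for all densities, so the constant in front of
the defect in \<open>L1_dist_le_defect\<close> is uniform too.\<close>

lemma densities_uniformly_convex:
  assumes W: "W \<subseteq> ac_measures M" and ui: "uniformly_integrable_measures M W" and e: "0 < e"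
  shows "\<exists>d>0. \<forall>f\<in>densities M W. \<forall>g\<in>densities M W.
    ((LINT \<omega>|M. exp (- f \<omega>)) + (LINT \<omega>|M. exp (- g \<omega>))) / 2
        - (LINT \<omega>|M. exp (- ((f \<omega> + g \<omega>) / 2))) < d \<longrightarrow> (LINT \<omega>|M. \<bar>f \<omega> - g \<omega>\<bar>) < e"
proof -
  have e4: "0 < e / 4" using e by simp
  obtain c where c: "\<forall>f\<in>densities M W. (LINT \<omega>|M. max 0 (f \<omega> - c)) \<le> e / 4"
    using densities_uniform_tail[OF W ui e4] by blast
  define C where "C = 2 * exp c / (e / 4)"
  have C: "0 < C" using e by (simp add: C_def)
  define d where "d = (e / 4) / C"
  have "(LINT \<omega>|M. \<bar>f \<omega> - g \<omega>\<bar>) < e" if f: "f \<in> densities M W" and g: "g \<in> densities M W"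
    and d: "((LINT \<omega>|M. exp (- f \<omega>)) + (LINT \<omega>|M. exp (- g \<omega>))) / 2
        - (LINT \<omega>|M. exp (- ((f \<omega> + g \<omega>) / 2))) < d" (is "?d < d") for f g
  proof -
    have "C * ?d < e / 4" using d C by (simp add: d_def pos_less_divide_eq mult.commute)
    moreover have "(LINT \<omega>|M. \<bar>f \<omega> - g \<omega>\<bar>) \<le> e / 4 + C * ?d + (LINT \<omega>|M. max 0 (f \<omega> - c)) + (LINT \<omega>|M. max 0 (g \<omega> - c))"
      unfolding C_def by (rule L1_dist_le_defect[OF W f g e4])
    moreover have "(LINT \<omega>|M. max 0 (f \<omega> - c)) \<le> e / 4" "(LINT \<omega>|M. max 0 (g \<omega> - c)) \<le> e / 4"
      using c f g by blast+
    ultimately show ?thesis using e by linarith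
  qed
  moreover have "0 < d" using C e by (simp add: d_def)
  ultimately show ?thesis by blast
qed

lemma exp_defect_nonneg:
  assumes W: "W \<subseteq> ac_measures M" and f: "f \<in> densities M W" and g: "g \<in> densities M W"
  shows "0 \<le> ((LINT \<omega>|M. exp (- f \<omega>)) + (LINT \<omega>|M. exp (- g \<omega>))) / 2
        - (LINT \<omega>|M. exp (- ((f \<omega> + g \<omega>) / 2)))"
proof -
  note [measurable] = densitiesD(1)[OF f] densitiesD(1)[OF g]
  note [simp] = densitiesD(2)[OF f] densitiesD(2)[OF g]
  have [simp]: "integrable M (\<lambda>\<omega>. exp (- f \<omega>))" "integrable M (\<lambda>\<omega>. exp (- g \<omega>))"
      "integrable M (\<lambda>\<omega>. exp (- ((f \<omega> + g \<omega>) / 2)))"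
    by (auto intro!: integrable_const_bound[of _ 1])
  have "exp (- ((a + b) / 2)) \<le> (exp (- a) + exp (- b)) / 2" for a b :: real
    using exp_defect_eq_square[of a b] zero_le_power2[of "exp (- a / 2) - exp (- b / 2)"] by linarith
  then have "(LINT \<omega>|M. exp (- ((f \<omega> + g \<omega>) / 2))) \<le> (LINT \<omega>|M. (exp (- f \<omega>) + exp (- g \<omega>)) / 2)"
    by (intro integral_mono) auto
  then show ?thesis by simp
qed

end

lemma L1s_pairing:
  assumes W: "W \<subseteq> ac_measures M" and X: "X \<in> L1s M W" and f: "f \<in> densities M W"
  shows "integrable M (\<lambda>\<omega>. f \<omega> * X \<omega>)"
    "(LINT \<omega>|density M (\<lambda>\<omega>. ennreal (f \<omega>)). X \<omega>) = (LINT \<omega>|M. f \<omega> * X \<omega>)"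
proof -
  note [measurable] = densitiesD(1)[OF f]
  have [measurable]: "X \<in> borel_measurable M" using X by (simp add: L1s_def)
  show "integrable M (\<lambda>\<omega>. f \<omega> * X \<omega>)"
    using L1s_integrable[OF W X densitiesD(3)[OF f]] densitiesD(2)[OF f]
    by (subst (asm) integrable_density) auto
  show "(LINT \<omega>|density M (\<lambda>\<omega>. ennreal (f \<omega>)). X \<omega>) = (LINT \<omega>|M. f \<omega> * X \<omega>)"
    using densitiesD(2)[OF f] by (subst integral_density) auto
qed

lemma L1s_pairing_bound:
  assumes W: "W \<subseteq> ac_measures M" and X: "X \<in> L1s M W"
  shows "\<exists>b. \<forall>f\<in>densities M W. \<bar>LINT \<omega>|M. f \<omega> * X \<omega>\<bar> \<le> b"
proof -
  obtain b where b: "\<forall>Q\<in>W. (\<integral>\<^sup>+\<omega>. ennreal \<bar>X \<omega>\<bar> \<partial>Q) \<le> ennreal b"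
    using L1s_nn_integral_bound[OF W X] by blast
  have "\<bar>LINT \<omega>|M. f \<omega> * X \<omega>\<bar> \<le> max 0 b" if f: "f \<in> densities M W" for f
  proof -
    let ?Q = "density M (\<lambda>\<omega>. ennreal (f \<omega>))"
    note Q = densitiesD(3)[OF f]
    note int = L1s_integrable[OF W X Q]
    have "\<bar>LINT \<omega>|?Q. X \<omega>\<bar> \<le> (LINT \<omega>|?Q. \<bar>X \<omega>\<bar>)" by (rule integral_abs_bound)
    also have "\<dots> = enn2real (\<integral>\<^sup>+\<omega>. ennreal \<bar>X \<omega>\<bar> \<partial>?Q)"
      by (rule integral_eq_nn_integral) (use borel_measurable_integrable[OF int] in auto)
    also have "\<dots> \<le> max 0 b"
      using b[rule_format, OF Q] by (intro enn2real_leI) (auto simp: ennreal_max_0)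
    finally show ?thesis unfolding L1s_pairing(2)[OF W X f] .
  qed
  then show ?thesis by blast
qed

text \<open>Below the level \<open>c\<close> the random variable \<open>X\<close> is bounded and the pairing is \<open>L\<^sup>1\<close>-continuous; the part of \<open>X\<close>
above \<open>c\<close> has a small integral against all densities simultaneously, as \<open>X\<close> lies in \<open>L\<^sub>s\<^sup>1\<close>.\<close>

lemma L1s_pairing_continuous:
  assumes W: "W \<subseteq> ac_measures M" and X: "X \<in> L1s M W"
    and u: "\<And>k::nat. u k \<in> densities M W" and l: "l \<in> densities M W"
    and lim: "(\<lambda>k. LINT \<omega>|M. \<bar>u k \<omega> - l \<omega>\<bar>) \<longlonglongrightarrow> 0"
  shows "(\<lambda>k. LINT \<omega>|M. u k \<omega> * X \<omega>) \<longlonglongrightarrow> (LINT \<omega>|M. l \<omega> * X \<omega>)"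
proof (rule LIMSEQ_I)
  fix e :: real assume e: "0 < e"
  have Xm[measurable]: "X \<in> borel_measurable M" using X by (simp add: L1s_def)
  have e4: "0 < e / 4" using e by simp
  obtain c where c: "0 < c" "\<forall>Q\<in>W. (\<integral>\<^sup>+\<omega>. ennreal (\<bar>X \<omega>\<bar> - c) \<partial>Q) \<le> ennreal (e / 4)"
    using X e4 unfolding L1s_iff[OF W] by blast
  define T where "T \<omega> = max 0 (\<bar>X \<omega>\<bar> - c)" for \<omega>
  have Tm[measurable]: "T \<in> borel_measurable M" unfolding T_def by measurable
  have T: "integrable M (\<lambda>\<omega>. f \<omega> * T \<omega>)" "(LINT \<omega>|M. f \<omega> * T \<omega>) \<le> e / 4" if f: "f \<in> densities M W" for f
  proof -
    note [measurable] = densitiesD(1)[OF f]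
    have "(\<integral>\<^sup>+\<omega>. ennreal (f \<omega> * T \<omega>) \<partial>M) = (\<integral>\<^sup>+\<omega>. ennreal (\<bar>X \<omega>\<bar> - c) \<partial>density M (\<lambda>\<omega>. ennreal (f \<omega>)))"
      using densitiesD(2)[OF f] by (subst nn_integral_density) (auto simp: T_def ennreal_mult)
    also have "\<dots> \<le> ennreal (e / 4)" using c(2) densitiesD(3)[OF f] by blast
    finally have le: "(\<integral>\<^sup>+\<omega>. ennreal (f \<omega> * T \<omega>) \<partial>M) \<le> ennreal (e / 4)" .
    have nn: "0 \<le> f \<omega> * T \<omega>" for \<omega> using densitiesD(2)[OF f] by (simp add: T_def)
    show "integrable M (\<lambda>\<omega>. f \<omega> * T \<omega>)"
      using le nn by (intro integrableI_bounded) (auto intro: le_less_trans)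
    have "(LINT \<omega>|M. f \<omega> * T \<omega>) = enn2real (\<integral>\<^sup>+\<omega>. ennreal (f \<omega> * T \<omega>) \<partial>M)"
      by (rule integral_eq_nn_integral) (use nn in auto)
    also have "\<dots> \<le> e / 4" using le e by (intro enn2real_leI) auto
    finally show "(LINT \<omega>|M. f \<omega> * T \<omega>) \<le> e / 4" .
  qed
  have "0 < e / (4 * c)" using e c(1) by simp
  from LIMSEQ_D[OF lim this] obtain K where
    K: "\<And>k. K \<le> k \<Longrightarrow> (LINT \<omega>|M. \<bar>u k \<omega> - l \<omega>\<bar>) < e / (4 * c)" by auto
  have "norm ((LINT \<omega>|M. u k \<omega> * X \<omega>) - (LINT \<omega>|M. l \<omega> * X \<omega>)) < e" if k: "K \<le> k" for k
  proof -
    note int = density_integrable[OF W u, of k] density_integrable[OF W l]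
    have dint: "integrable M (\<lambda>\<omega>. \<bar>u k \<omega> - l \<omega>\<bar>)" using int by auto
    have "(LINT \<omega>|M. u k \<omega> * X \<omega>) - (LINT \<omega>|M. l \<omega> * X \<omega>) = (LINT \<omega>|M. u k \<omega> * X \<omega> - l \<omega> * X \<omega>)"
      by (rule Bochner_Integration.integral_diff[symmetric]) (intro L1s_pairing(1)[OF W X] u l)+
    also have "\<bar>\<dots>\<bar> \<le> (LINT \<omega>|M. \<bar>u k \<omega> * X \<omega> - l \<omega> * X \<omega>\<bar>)" by (rule integral_abs_bound)
    also have "\<dots> \<le> (LINT \<omega>|M. c * \<bar>u k \<omega> - l \<omega>\<bar> + u k \<omega> * T \<omega> + l \<omega> * T \<omega>)"
    proof (rule integral_mono)
      show "integrable M (\<lambda>\<omega>. \<bar>u k \<omega> * X \<omega> - l \<omega> * X \<omega>\<bar>)"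
        using L1s_pairing(1)[OF W X] u l by auto
      show "integrable M (\<lambda>\<omega>. c * \<bar>u k \<omega> - l \<omega>\<bar> + u k \<omega> * T \<omega> + l \<omega> * T \<omega>)"
        using dint T(1) u l by auto
      fix \<omega>
      have nn: "0 \<le> u k \<omega>" "0 \<le> l \<omega>" using densitiesD(2)[OF u] densitiesD(2)[OF l] by auto
      have "\<bar>u k \<omega> * X \<omega> - l \<omega> * X \<omega>\<bar> = \<bar>u k \<omega> - l \<omega>\<bar> * \<bar>X \<omega>\<bar>"
        by (simp add: left_diff_distrib[symmetric] abs_mult)
      also have "\<dots> \<le> \<bar>u k \<omega> - l \<omega>\<bar> * (c + T \<omega>)" by (intro mult_left_mono) (auto simp: T_def)
      also have "\<dots> = c * \<bar>u k \<omega> - l \<omega>\<bar> + \<bar>u k \<omega> - l \<omega>\<bar> * T \<omega>" by (simp add: algebra_simps)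
      also have "\<dots> \<le> c * \<bar>u k \<omega> - l \<omega>\<bar> + (u k \<omega> + l \<omega>) * T \<omega>"
        using nn by (intro add_left_mono mult_right_mono) (auto simp: T_def)
      finally show "\<bar>u k \<omega> * X \<omega> - l \<omega> * X \<omega>\<bar> \<le> c * \<bar>u k \<omega> - l \<omega>\<bar> + u k \<omega> * T \<omega> + l \<omega> * T \<omega>"
        by (simp add: algebra_simps)
    qed
    also have "\<dots> = c * (LINT \<omega>|M. \<bar>u k \<omega> - l \<omega>\<bar>) + (LINT \<omega>|M. u k \<omega> * T \<omega>) + (LINT \<omega>|M. l \<omega> * T \<omega>)"
      using dint T(1)[OF u] T(1)[OF l] by simp
    also have "\<dots> \<le> c * (e / (4 * c)) + e / 4 + e / 4"
      using K[OF k] c(1) T(2)[OF u] T(2)[OF l] by (intro add_mono mult_left_mono) auto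
    also have "\<dots> < e" using c(1) e by simp
    finally show ?thesis by simp
  qed
  then show "\<exists>K. \<forall>k\<ge>K. norm ((LINT \<omega>|M. u k \<omega> * X \<omega>) - (LINT \<omega>|M. l \<omega> * X \<omega>)) < e" by blast
qed

section \<open>Separating tuples of measures\<close>

locale valuation_family = prob_space M for M :: "'a measure" +
  fixes N :: nat and V :: "nat \<Rightarrow> 'a measure set"
  assumes N_pos: "1 \<le> N"
    and V_ac: "\<And>n. n \<in> {1..N} \<Longrightarrow> V n \<subseteq> ac_measures M"
    and V_nonempty: "\<And>n. n \<in> {1..N} \<Longrightarrow> V n \<noteq> {}"
    and V_convex: "\<And>n. n \<in> {1..N} \<Longrightarrow> convex_measures M (V n)"
    and V_closed: "\<And>n. n \<in> {1..N} \<Longrightarrow> L1_closed M (V n)"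
    and V_uniformly_integrable: "\<And>n. n \<in> {1..N} \<Longrightarrow> uniformly_integrable_measures M (V n)"
begin

text \<open>The points of the minimax argument are tuples of densities, one for each group; only the
components with index in \<open>{1..N}\<close> count.\<close>

definition tuples :: "(nat \<Rightarrow> 'a \<Rightarrow> real) set" where
  "tuples = {F. \<forall>n\<in>{1..N}. F n \<in> densities M (V n)}"

definition L1_dist :: "(nat \<Rightarrow> 'a \<Rightarrow> real) \<Rightarrow> (nat \<Rightarrow> 'a \<Rightarrow> real) \<Rightarrow> real" where
  "L1_dist F G = (\<Sum>n=1..N. LINT \<omega>|M. \<bar>F n \<omega> - G n \<omega>\<bar>)"

definition mix :: "real \<Rightarrow> (nat \<Rightarrow> 'a \<Rightarrow> real) \<Rightarrow> (nat \<Rightarrow> 'a \<Rightarrow> real) \<Rightarrow> nat \<Rightarrow> 'a \<Rightarrow> real" where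
  "mix t F G n \<omega> = t * F n \<omega> + (1 - t) * G n \<omega>"

definition exp_energy :: "(nat \<Rightarrow> 'a \<Rightarrow> real) \<Rightarrow> real" where
  "exp_energy F = (\<Sum>n=1..N. LINT \<omega>|M. exp (- F n \<omega>))"

definition pairing :: "(nat \<Rightarrow> 'a \<Rightarrow> real) \<Rightarrow> (nat \<Rightarrow> 'a \<Rightarrow> real) \<Rightarrow> real" where
  "pairing Y F = (\<Sum>n=1..N. LINT \<omega>|M. F n \<omega> * Y n \<omega>)"

lemma tuplesD: "F \<in> tuples \<Longrightarrow> n \<in> {1..N} \<Longrightarrow> F n \<in> densities M (V n)"
  by (simp add: tuples_def)

lemma tuples_integrable: "F \<in> tuples \<Longrightarrow> n \<in> {1..N} \<Longrightarrow> integrable M (F n)"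
  using density_integrable[OF V_ac tuplesD] by blast

lemma L1_dist_component_le:
  assumes "n \<in> {1..N}"
  shows "(LINT \<omega>|M. \<bar>F n \<omega> - G n \<omega>\<bar>) \<le> L1_dist F G"
  unfolding L1_dist_def by (rule member_le_sum[OF assms]) auto

lemma exp_energy_uniformly_convex:
  assumes e: "0 < e"
  shows "\<exists>d>0. \<forall>F\<in>tuples. \<forall>G\<in>tuples.
    (exp_energy F + exp_energy G) / 2 - exp_energy (mix (1/2) F G) < d \<longrightarrow> L1_dist F G < e"
proof -
  define defect where "defect f g = ((LINT \<omega>|M. exp (- f \<omega>)) + (LINT \<omega>|M. exp (- g \<omega>))) / 2
      - (LINT \<omega>|M. exp (- ((f \<omega> + g \<omega>) / 2)))" for f g :: "'a \<Rightarrow> real"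
  \<comment> \<open>Each of the \<open>N\<close> components contributes less than \<open>e / N\<close> to the distance.\<close>
  have "0 < e / real N" using e N_pos by simp
  then have "\<forall>n\<in>{1..N}. \<exists>d. 0 < d \<and> (\<forall>f\<in>densities M (V n). \<forall>g\<in>densities M (V n).
      defect f g < d \<longrightarrow> (LINT \<omega>|M. \<bar>f \<omega> - g \<omega>\<bar>) < e / real N)"
    unfolding defect_def using densities_uniformly_convex[OF V_ac V_uniformly_integrable] by blast
  from bchoice[OF this] obtain d where d: "\<And>n. n \<in> {1..N} \<Longrightarrow> 0 < d n"
    "\<And>n f g. n \<in> {1..N} \<Longrightarrow> f \<in> densities M (V n) \<Longrightarrow> g \<in> densities M (V n) \<Longrightarrow> defect f g < d n \<Longrightarrow>
      (LINT \<omega>|M. \<bar>f \<omega> - g \<omega>\<bar>) < e / real N" by blast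
  define d0 where "d0 = Min (d ` {1..N})"
  have ne: "{1..N} \<noteq> {}" using N_pos by simp
  have "d0 \<in> d ` {1..N}" unfolding d0_def using ne by (intro Min_in) auto
  then have "0 < d0" using d(1) by blast
  moreover have "L1_dist F G < e"
    if F: "F \<in> tuples" and G: "G \<in> tuples"
      and lt: "(exp_energy F + exp_energy G) / 2 - exp_energy (mix (1/2) F G) < d0" for F G
  proof -
    have half: "exp_energy (mix (1/2) F G) = (\<Sum>n=1..N. LINT \<omega>|M. exp (- ((F n \<omega> + G n \<omega>) / 2)))"
      by (simp add: exp_energy_def mix_def add_divide_distrib)
    have "(exp_energy F + exp_energy G) / 2 - exp_energy (mix (1/2) F G)
        = (\<Sum>n=1..N. defect (F n) (G n))"
      unfolding half by (simp add: exp_energy_def defect_def sum.distrib sum_subtractf flip: sum_divide_distrib)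
    with lt have sum_lt: "(\<Sum>n=1..N. defect (F n) (G n)) < d0" by simp
    have "(LINT \<omega>|M. \<bar>F n \<omega> - G n \<omega>\<bar>) < e / real N" if n: "n \<in> {1..N}" for n
    proof -
      have "defect (F n) (G n) \<le> (\<Sum>n=1..N. defect (F n) (G n))"
        using exp_defect_nonneg[OF V_ac tuplesD[OF F] tuplesD[OF G]]
        by (intro member_le_sum[OF n]) (auto simp: defect_def)
      also have "\<dots> < d0" by (rule sum_lt)
      also have "d0 \<le> d n" unfolding d0_def using n by (intro Min_le) auto
      finally show ?thesis by (rule d(2)[OF n tuplesD[OF F n] tuplesD[OF G n]])
    qed
    then have "L1_dist F G < of_nat (card {1..N}) * (e / real N)"
      unfolding L1_dist_def using N_pos by (intro sum_bounded_above_strict) auto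
    then show ?thesis using N_pos by simp
  qed
  ultimately show ?thesis by blast
qed

sublocale uniformly_convex_domain tuples L1_dist mix exp_energy
proof
  show "0 \<le> L1_dist F G" for F G by (auto simp: L1_dist_def intro!: sum_nonneg)
next
  fix F G H assume FGH: "F \<in> tuples" "G \<in> tuples" "H \<in> tuples"
  have "(LINT \<omega>|M. \<bar>F n \<omega> - H n \<omega>\<bar>) \<le> (LINT \<omega>|M. \<bar>F n \<omega> - G n \<omega>\<bar>) + (LINT \<omega>|M. \<bar>G n \<omega> - H n \<omega>\<bar>)"
    if n: "n \<in> {1..N}" for n
  proof -
    note [simp] = tuples_integrable[OF FGH(1) n] tuples_integrable[OF FGH(2) n] tuples_integrable[OF FGH(3) n]
    have "(LINT \<omega>|M. \<bar>F n \<omega> - H n \<omega>\<bar>) \<le> (LINT \<omega>|M. \<bar>F n \<omega> - G n \<omega>\<bar> + \<bar>G n \<omega> - H n \<omega>\<bar>)"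
      by (intro integral_mono) auto
    then show ?thesis by simp
  qed
  then show "L1_dist F H \<le> L1_dist F G + L1_dist G H"
    unfolding L1_dist_def sum.distrib[symmetric] by (rule sum_mono)
next
  fix u :: "nat \<Rightarrow> nat \<Rightarrow> 'a \<Rightarrow> real"
  assume u: "\<And>k. u k \<in> tuples"
    and cauchy: "\<And>e. 0 < e \<Longrightarrow> \<exists>K. \<forall>k\<ge>K. \<forall>m\<ge>K. L1_dist (u k) (u m) < e"
  have "\<forall>n\<in>{1..N}. \<exists>g. g \<in> densities M (V n) \<and> (\<lambda>k. LINT \<omega>|M. \<bar>u k n \<omega> - g \<omega>\<bar>) \<longlonglongrightarrow> 0"
  proof
    fix n assume n: "n \<in> {1..N}"
    have "\<exists>K. \<forall>i\<ge>K. \<forall>j\<ge>K. (LINT \<omega>|M. \<bar>u i n \<omega> - u j n \<omega>\<bar>) < e" if "0 < e" for e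
      using cauchy[OF that] L1_dist_component_le[OF n] by (meson le_less_trans)
    from densities_L1_complete[OF V_ac[OF n] V_closed[OF n] tuplesD[OF u n] this]
    show "\<exists>g. g \<in> densities M (V n) \<and> (\<lambda>k. LINT \<omega>|M. \<bar>u k n \<omega> - g \<omega>\<bar>) \<longlonglongrightarrow> 0" by blast
  qed
  from bchoice[OF this] obtain l where l: "\<And>n. n \<in> {1..N} \<Longrightarrow> l n \<in> densities M (V n)"
    "\<And>n. n \<in> {1..N} \<Longrightarrow> (\<lambda>k. LINT \<omega>|M. \<bar>u k n \<omega> - l n \<omega>\<bar>) \<longlonglongrightarrow> 0" by blast
  have "l \<in> tuples" using l(1) by (simp add: tuples_def)
  moreover have "(\<lambda>k. L1_dist (u k) l) \<longlonglongrightarrow> 0"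
    unfolding L1_dist_def by (intro tendsto_null_sum l(2))
  ultimately show "\<exists>l\<in>tuples. (\<lambda>k. L1_dist (u k) l) \<longlonglongrightarrow> 0" by blast
next
  fix t :: real and F G assume t: "t \<in> {0..1}" and FG: "F \<in> tuples" "G \<in> tuples"
  have "mix t F G n \<in> densities M (V n)" if n: "n \<in> {1..N}" for n
    using densities_convex[OF V_ac[OF n] V_convex[OF n] tuplesD[OF FG(1) n] tuplesD[OF FG(2) n] t]
    by (simp add: mix_def[abs_def])
  then show "mix t F G \<in> tuples" by (simp add: tuples_def)
next
  show "bdd_below (exp_energy ` tuples)"
    by (intro bdd_belowI[of _ 0]) (auto simp: exp_energy_def intro!: sum_nonneg)
next
  have "exp_energy F \<le> (\<Sum>n=1..N. 1)" if F: "F \<in> tuples" for F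
    unfolding exp_energy_def
  proof (rule sum_mono)
    fix n assume n: "n \<in> {1..N}"
    note [measurable] = densitiesD(1)[OF tuplesD[OF F n]]
    note [simp] = densitiesD(2)[OF tuplesD[OF F n]]
    have "integrable M (\<lambda>\<omega>. exp (- F n \<omega>))" by (auto intro!: integrable_const_bound[of _ 1])
    then show "(LINT \<omega>|M. exp (- F n \<omega>)) \<le> 1" by (rule integral_le_const) auto
  qed
  then show "bdd_above (exp_energy ` tuples)" by (intro bdd_aboveI2)
qed (rule exp_energy_uniformly_convex)

lemma L1s_commonD: "X \<in> L1s_common M N V \<Longrightarrow> n \<in> {1..N} \<Longrightarrow> X \<in> L1s M (V n)"
  by (auto simp: L1s_common_def)

lemma L1s_commonI: "(\<And>n. n \<in> {1..N} \<Longrightarrow> X \<in> L1s M (V n)) \<Longrightarrow> X \<in> L1s_common M N V"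
  by (auto simp: L1s_common_def)

lemma L1s_common_bounded:
  "X \<in> borel_measurable M \<Longrightarrow> (\<And>\<omega>. \<bar>X \<omega>\<bar> \<le> b) \<Longrightarrow> X \<in> L1s_common M N V"
  using L1s_bounded[OF V_ac] by (blast intro: L1s_commonI)

lemma L1s_common_add:
  "X \<in> L1s_common M N V \<Longrightarrow> Y \<in> L1s_common M N V \<Longrightarrow> (\<lambda>\<omega>. X \<omega> + Y \<omega>) \<in> L1s_common M N V"
  using L1s_add[OF V_ac] by (simp add: L1s_common_def)

lemma L1s_common_cmult:
  "X \<in> L1s_common M N V \<Longrightarrow> (\<lambda>\<omega>. t * X \<omega>) \<in> L1s_common M N V"
  using L1s_cmult[OF V_ac] by (simp add: L1s_common_def)

lemma L1s_common_integrable: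
  "F \<in> tuples \<Longrightarrow> X \<in> L1s_common M N V \<Longrightarrow> n \<in> {1..N} \<Longrightarrow> integrable M (\<lambda>\<omega>. F n \<omega> * X \<omega>)"
  using L1s_pairing(1)[OF V_ac L1s_commonD tuplesD] by blast

lemma pairing_mix:
  assumes Y: "\<And>n. n \<in> {1..N} \<Longrightarrow> Y n \<in> L1s_common M N V" and F: "F \<in> tuples" and G: "G \<in> tuples"
  shows "pairing Y (mix t F G) = t * pairing Y F + (1 - t) * pairing Y G"
proof -
  have "(LINT \<omega>|M. mix t F G n \<omega> * Y n \<omega>)
      = t * (LINT \<omega>|M. F n \<omega> * Y n \<omega>) + (1 - t) * (LINT \<omega>|M. G n \<omega> * Y n \<omega>)" if n: "n \<in> {1..N}" for n
  proof -
    note [simp] = L1s_common_integrable[OF F Y[OF n] n] L1s_common_integrable[OF G Y[OF n] n]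
    have "(LINT \<omega>|M. mix t F G n \<omega> * Y n \<omega>)
        = (LINT \<omega>|M. t * (F n \<omega> * Y n \<omega>) + (1 - t) * (G n \<omega> * Y n \<omega>))"
      by (intro Bochner_Integration.integral_cong) (simp_all add: mix_def algebra_simps)
    then show ?thesis by simp
  qed
  then show ?thesis by (simp add: pairing_def sum.distrib sum_distrib_left)
qed

lemma pairing_combination:
  assumes Y: "\<And>n. n \<in> {1..N} \<Longrightarrow> Y n \<in> L1s_common M N V"
    and Z: "\<And>n. n \<in> {1..N} \<Longrightarrow> Z n \<in> L1s_common M N V" and F: "F \<in> tuples"
  shows "pairing (\<lambda>n \<omega>. s * Y n \<omega> + t * Z n \<omega>) F = s * pairing Y F + t * pairing Z F"
proof -
  have "(LINT \<omega>|M. F n \<omega> * (s * Y n \<omega> + t * Z n \<omega>))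
      = s * (LINT \<omega>|M. F n \<omega> * Y n \<omega>) + t * (LINT \<omega>|M. F n \<omega> * Z n \<omega>)" if n: "n \<in> {1..N}" for n
  proof -
    note [simp] = L1s_common_integrable[OF F Y[OF n] n] L1s_common_integrable[OF F Z[OF n] n]
    have "(LINT \<omega>|M. F n \<omega> * (s * Y n \<omega> + t * Z n \<omega>))
        = (LINT \<omega>|M. s * (F n \<omega> * Y n \<omega>) + t * (F n \<omega> * Z n \<omega>))"
      by (intro Bochner_Integration.integral_cong) (simp_all add: algebra_simps)
    then show ?thesis by simp
  qed
  then show ?thesis by (simp add: pairing_def sum.distrib sum_distrib_left)
qed

lemma pairing_continuous:
  assumes Y: "\<And>n. n \<in> {1..N} \<Longrightarrow> Y n \<in> L1s_common M N V"
    and u: "\<And>k::nat. u k \<in> tuples" and l: "l \<in> tuples" and lim: "(\<lambda>k. L1_dist (u k) l) \<longlonglongrightarrow> 0"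
  shows "(\<lambda>k. pairing Y (u k)) \<longlonglongrightarrow> pairing Y l"
  unfolding pairing_def
proof (rule tendsto_sum)
  fix n assume n: "n \<in> {1..N}"
  have "(\<lambda>k. LINT \<omega>|M. \<bar>u k n \<omega> - l n \<omega>\<bar>) \<longlonglongrightarrow> 0"
    by (rule tendsto_sandwich[OF _ _ tendsto_const lim]) (auto simp: L1_dist_component_le[OF n])
  then show "(\<lambda>k. LINT \<omega>|M. u k n \<omega> * Y n \<omega>) \<longlonglongrightarrow> (LINT \<omega>|M. l n \<omega> * Y n \<omega>)"
    by (intro L1s_pairing_continuous[OF V_ac[OF n] L1s_commonD[OF Y n]] tuplesD u l n)
qed

text \<open>The infimum of the pairing over all tuples is the sum of the infima \<open>m n\<close> over the groups, since the
components of a tuple are chosen independently. If it is positive, moving the constant \<open>s - m n\<close> into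
the share of group \<open>n\<close>, where \<open>s\<close> is the average of the \<open>m n\<close>, keeps the sum of the shares and gives
every group the same positive infimum \<open>s\<close>.\<close>

lemma acceptable_of_pairing_bound:
  assumes Y: "\<And>n. n \<in> {1..N} \<Longrightarrow> Y n \<in> L1s_common M N V"
    and X: "X \<in> L1s_common M N V" and sum: "AE \<omega> in M. (\<Sum>n=1..N. Y n \<omega>) = X \<omega>"
    and \<delta>: "0 < \<delta>" and ge: "\<And>F. F \<in> tuples \<Longrightarrow> \<delta> \<le> pairing Y F"
  shows "X \<in> acceptable M N V"
proof -
  define m where "m n = (INF f\<in>densities M (V n). LINT \<omega>|M. f \<omega> * Y n \<omega>)" for n
  have bdd: "bdd_below ((\<lambda>f. LINT \<omega>|M. f \<omega> * Y n \<omega>) ` densities M (V n))" if n: "n \<in> {1..N}" for n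
  proof -
    obtain b where "\<forall>f\<in>densities M (V n). \<bar>LINT \<omega>|M. f \<omega> * Y n \<omega>\<bar> \<le> b"
      using L1s_pairing_bound[OF V_ac[OF n] L1s_commonD[OF Y[OF n] n]] by blast
    then show ?thesis by (intro bdd_belowI2[of _ "- b"]) (simp add: abs_le_iff minus_le_iff)
  qed
  have N0: "0 < real N" using N_pos by simp
  \<comment> \<open>Near-minimizers in all groups together miss the sum of the infima by at most \<open>\<delta> / 2\<close>.\<close>
  define \<eta> where "\<eta> = \<delta> / (2 * real N)"
  have \<eta>: "0 < \<eta>" "real N * \<eta> = \<delta> / 2" using \<delta> N0 by (simp_all add: \<eta>_def)
  have "\<forall>n\<in>{1..N}. \<exists>f. f \<in> densities M (V n) \<and> (LINT \<omega>|M. f \<omega> * Y n \<omega>) < m n + \<eta>"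
  proof
    fix n assume n: "n \<in> {1..N}"
    have "densities M (V n) \<noteq> {}" using V_nonempty[OF n] dens_in_densities(1)[OF V_ac[OF n]] by blast
    moreover have "m n < m n + \<eta>" using \<eta> by simp
    ultimately show "\<exists>f. f \<in> densities M (V n) \<and> (LINT \<omega>|M. f \<omega> * Y n \<omega>) < m n + \<eta>"
      using cINF_less_iff[OF _ bdd[OF n]] unfolding m_def by blast
  qed
  from bchoice[OF this] obtain F where F: "\<And>n. n \<in> {1..N} \<Longrightarrow> F n \<in> densities M (V n)"
    "\<And>n. n \<in> {1..N} \<Longrightarrow> (LINT \<omega>|M. F n \<omega> * Y n \<omega>) < m n + \<eta>" by blast
  have "\<delta> \<le> pairing Y F" by (rule ge) (simp add: tuples_def F(1))
  also have "\<dots> \<le> (\<Sum>n=1..N. m n + \<eta>)"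
    unfolding pairing_def by (intro sum_mono less_imp_le F(2))
  also have "\<dots> = (\<Sum>n=1..N. m n) + \<delta> / 2" using \<eta>(2) by (simp add: sum.distrib)
  finally have sum_m: "\<delta> / 2 \<le> (\<Sum>n=1..N. m n)" by simp
  define s where "s = (\<Sum>n=1..N. m n) / real N"
  have s: "0 < s" using sum_m \<delta> N0 by (simp add: s_def)
  define Z where "Z n \<omega> = Y n \<omega> + (s - m n)" for n \<omega>
  have Z: "Z n \<in> L1s_common M N V" if n: "n \<in> {1..N}" for n
    unfolding Z_def[abs_def] by (intro L1s_common_add Y n L1s_common_bounded[of _ "\<bar>s - m n\<bar>"]) auto
  have "(\<Sum>n=1..N. Z n \<omega>) = (\<Sum>n=1..N. Y n \<omega>)" for \<omega>
    using N0 by (simp add: Z_def s_def sum.distrib sum_subtractf)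
  with sum have sumZ: "AE \<omega> in M. (\<Sum>n=1..N. Z n \<omega>) = X \<omega>" by simp
  have "Z n \<in> group_acceptable M N V n" if n: "n \<in> {1..N}" for n
  proof -
    have "ereal s \<le> expect Q (Z n)" if Q: "Q \<in> V n" for Q
    proof -
      interpret Q: prob_space Q using V_ac[OF n] Q by (auto simp: ac_measures_def)
      note dens = dens_in_densities[OF V_ac[OF n] Q]
      note Yn = L1s_commonD[OF Y[OF n] n]
      note int = L1s_integrable[OF V_ac[OF n] Yn Q]
      have "m n \<le> (LINT \<omega>|M. dens M Q \<omega> * Y n \<omega>)"
        unfolding m_def by (rule cINF_lower[OF bdd[OF n] dens(1)])
      also have "\<dots> = (LINT \<omega>|Q. Y n \<omega>)"
        using L1s_pairing(2)[OF V_ac[OF n] Yn dens(1)] dens(2) by simp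
      finally have "s \<le> (LINT \<omega>|Q. Z n \<omega>)"
        using int by (simp add: Z_def[abs_def] Q.prob_space)
      then show ?thesis
        using expect_eq_integral[OF L1s_integrable[OF V_ac[OF n] L1s_commonD[OF Z[OF n] n] Q]] by simp
    qed
    then have "ereal s \<le> (INF Q\<in>V n. expect Q (Z n))" by (rule INF_greatest)
    moreover have "0 < ereal s" using s by simp
    ultimately have "0 < (INF Q\<in>V n. expect Q (Z n))" by (rule less_le_trans[rotated])
    then show ?thesis using Z[OF n] by (simp add: group_acceptable_def)
  qed
  with X Z sumZ show ?thesis unfolding acceptable_def by blast
qed

text \<open>Under a measure common to all groups, expectations of the shares are positive and add up.\<close>

lemma expect_sum_pos:
  assumes Q: "Q \<in> (\<Inter>n\<in>{1..N}. V n)" and X: "X \<in> acceptable M N V"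
  shows "0 < expect Q X"
proof -
  obtain Y where Y: "\<And>n. n \<in> {1..N} \<Longrightarrow> Y n \<in> group_acceptable M N V n"
    and sum: "AE \<omega> in M. (\<Sum>n=1..N. Y n \<omega>) = X \<omega>"
    using X unfolding acceptable_def by blast
  have one: "1 \<in> {1..N}" using N_pos by simp
  have QV: "Q \<in> V n" if "n \<in> {1..N}" for n using Q that by blast
  have ac: "absolutely_continuous M Q" "sets Q = sets M" using V_ac[OF one] QV[OF one] by (auto simp: ac_measures_def)
  have Yint: "integrable Q (Y n)" if n: "n \<in> {1..N}" for n
    using Y[OF n] by (intro L1s_integrable[OF V_ac[OF n] L1s_commonD[OF _ n] QV[OF n]]) (simp add: group_acceptable_def)
  have Xint: "integrable Q X"
    using X by (intro L1s_integrable[OF V_ac[OF one] L1s_commonD[OF _ one] QV[OF one]]) (auto simp: acceptable_def)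
  have Ypos: "0 < (LINT \<omega>|Q. Y n \<omega>)" if n: "n \<in> {1..N}" for n
  proof -
    have "0 < (INF Q\<in>V n. expect Q (Y n))" using Y[OF n] by (simp add: group_acceptable_def)
    also have "\<dots> \<le> expect Q (Y n)" by (rule INF_lower[OF QV[OF n]])
    finally show ?thesis by (simp add: expect_eq_integral[OF Yint[OF n]])
  qed
  have "AE \<omega> in Q. (\<Sum>n=1..N. Y n \<omega>) = X \<omega>"
    by (rule absolutely_continuous_AE[OF ac(2) ac(1) sum])
  then have "(LINT \<omega>|Q. X \<omega>) = (LINT \<omega>|Q. (\<Sum>n=1..N. Y n \<omega>))"
    using Xint Yint by (intro integral_cong_AE) (auto intro!: borel_measurable_integrable borel_measurable_sum)
  also have "\<dots> = (\<Sum>n=1..N. LINT \<omega>|Q. Y n \<omega>)" by (rule Bochner_Integration.integral_sum) (rule Yint)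
  also have "0 < \<dots>" using one by (intro sum_pos Ypos) auto
  finally show ?thesis by (simp add: expect_eq_integral[OF Xint])
qed

text \<open>Every decomposition of an element of \<open>A\<close> pairs nearly nonpositively with some tuple, because of
\<open>acceptable_of_pairing_bound\<close>; minimax turns this into one tuple that works for all decompositions.
The decompositions form a convex set, as \<open>A\<close> does.\<close>

lemma separating_tuple:
  assumes A: "A \<noteq> {}" "A \<subseteq> L1s_common M N V" "convex_rvs M A" and nsao: "A \<inter> acceptable M N V = {}"
  shows "\<exists>F\<in>tuples. \<forall>Y X. X \<in> A \<longrightarrow> (\<forall>n\<in>{1..N}. Y n \<in> L1s_common M N V) \<longrightarrow>
    (AE \<omega> in M. (\<Sum>n=1..N. Y n \<omega>) = X \<omega>) \<longrightarrow> pairing Y F \<le> 0"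
proof -
  define S where "S = {Y. (\<forall>n\<in>{1..N}. Y n \<in> L1s_common M N V) \<and>
    (\<exists>X\<in>A. AE \<omega> in M. (\<Sum>n=1..N. Y n \<omega>) = X \<omega>)}"
  have SD: "Y n \<in> L1s_common M N V" if "Y \<in> S" "n \<in> {1..N}" for Y n using that by (auto simp: S_def)
  have "\<exists>F\<in>tuples. \<forall>\<phi>\<in>pairing ` S. \<phi> F \<le> 0"
  proof (rule minimax)
    fix \<phi> t F G assume "\<phi> \<in> pairing ` S" and FG: "F \<in> tuples" "G \<in> tuples"
    then obtain Y where Y: "Y \<in> S" "\<phi> = pairing Y" by blast
    show "\<phi> (mix t F G) = t * \<phi> F + (1 - t) * \<phi> G"
      unfolding Y(2) by (rule pairing_mix[OF SD[OF Y(1)] FG])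
  next
    fix \<phi> l and u :: "nat \<Rightarrow> _"
    assume "\<phi> \<in> pairing ` S" and u: "\<And>k. u k \<in> tuples" "l \<in> tuples" "(\<lambda>k. L1_dist (u k) l) \<longlonglongrightarrow> 0"
    from this(1) obtain Y where Y: "Y \<in> S" "\<phi> = pairing Y" by blast
    show "(\<lambda>k. \<phi> (u k)) \<longlonglongrightarrow> \<phi> l"
      unfolding Y(2) by (rule pairing_continuous[OF SD[OF Y(1)] u])
  next
    fix \<phi> \<psi> and t :: real assume "\<phi> \<in> pairing ` S" "\<psi> \<in> pairing ` S" and t: "t \<in> {0..1}"
    then obtain Y Z where YZ: "Y \<in> S" "Z \<in> S" "\<phi> = pairing Y" "\<psi> = pairing Z" by blast
    let ?W = "\<lambda>n \<omega>. t * Y n \<omega> + (1 - t) * Z n \<omega>"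
    obtain X X' where X: "X \<in> A" "AE \<omega> in M. (\<Sum>n=1..N. Y n \<omega>) = X \<omega>"
      and X': "X' \<in> A" "AE \<omega> in M. (\<Sum>n=1..N. Z n \<omega>) = X' \<omega>" using YZ by (auto simp: S_def)
    obtain U where U: "U \<in> A" "AE \<omega> in M. U \<omega> = t * X \<omega> + (1 - t) * X' \<omega>"
      using A(3) X(1) X'(1) t unfolding convex_rvs_def by blast
    have "AE \<omega> in M. (\<Sum>n=1..N. ?W n \<omega>) = U \<omega>"
      using X(2) X'(2) U(2) by eventually_elim (simp add: sum.distrib flip: sum_distrib_left)
    moreover have "\<forall>n\<in>{1..N}. ?W n \<in> L1s_common M N V"
      using SD YZ by (intro ballI L1s_common_add L1s_common_cmult) auto
    ultimately have "?W \<in> S" using U(1) by (auto simp: S_def)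
    moreover have "\<forall>F\<in>tuples. pairing ?W F = t * \<phi> F + (1 - t) * \<psi> F"
      unfolding YZ by (intro ballI pairing_combination SD[OF YZ(1)] SD[OF YZ(2)])
    ultimately show "\<exists>\<theta>\<in>pairing ` S. \<forall>F\<in>tuples. \<theta> F = t * \<phi> F + (1 - t) * \<psi> F" by blast
  next
    fix \<phi> and \<delta> :: real assume "\<phi> \<in> pairing ` S" and \<delta>: "0 < \<delta>"
    then obtain Y where Y: "Y \<in> S" "\<phi> = pairing Y" by blast
    then obtain X where X: "X \<in> A" "AE \<omega> in M. (\<Sum>n=1..N. Y n \<omega>) = X \<omega>" by (auto simp: S_def)
    show "\<exists>F\<in>tuples. \<phi> F < \<delta>"
    proof (rule ccontr)
      assume "\<not> ?thesis"
      then have "\<And>F. F \<in> tuples \<Longrightarrow> \<delta> \<le> pairing Y F" unfolding Y by (meson not_le)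
      from acceptable_of_pairing_bound[OF SD[OF Y(1)] _ X(2) \<delta> this] have "X \<in> acceptable M N V"
        using X(1) A(2) by blast
      with X(1) nsao show False by blast
    qed
  next
    have "\<forall>n\<in>{1..N}. \<exists>f. f \<in> densities M (V n)"
      using V_nonempty dens_in_densities(1)[OF V_ac] by blast
    from bchoice[OF this] show "tuples \<noteq> {}" unfolding tuples_def by blast
  qed
  then show ?thesis unfolding S_def by blast
qed

text \<open>Shifting \<open>t\<close> times an indicator from group \<open>j\<close> to group 1 leaves the sum of the shares unchanged for
every real \<open>t\<close>. A function that is affine in \<open>t\<close> and never positive is constant, so the densities of
the two groups give the event the same probability.\<close>

lemma separating_tuple_diagonal:
  assumes X: "X \<in> L1s_common M N V" and F: "F \<in> tuples"
    and le: "\<And>Y. (\<And>n. n \<in> {1..N} \<Longrightarrow> Y n \<in> L1s_common M N V) \<Longrightarrow> (\<And>\<omega>. (\<Sum>n=1..N. Y n \<omega>) = X \<omega>) \<Longrightarrow>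
      pairing Y F \<le> 0"
  shows "(LINT \<omega>|M. F 1 \<omega> * X \<omega>) \<le> 0"
    and "j \<in> {1..N} \<Longrightarrow> density M (\<lambda>\<omega>. ennreal (F j \<omega>)) = density M (\<lambda>\<omega>. ennreal (F 1 \<omega>))"
proof -
  have one: "1 \<in> {1..N}" using N_pos by simp
  have key: "(LINT \<omega>|M. F 1 \<omega> * X \<omega>) + t * ((LINT \<omega>|M. F 1 \<omega> * indicator E \<omega>) - (LINT \<omega>|M. F j \<omega> * indicator E \<omega>)) \<le> 0"
    if j: "j \<in> {1..N}" and E: "E \<in> sets M" for j t E
  proof -
    \<comment> \<open>Group 1 receives \<open>X\<close> and \<open>t\<close> times the indicator, group \<open>j\<close> pays the latter; for \<open>j = 1\<close> the two cancel.\<close>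
    define a where "a n = (if n = 1 then 1 else 0 :: real)" for n :: nat
    define b where "b n = t * ((if n = 1 then 1 else 0) - (if n = j then 1 else 0 :: real))" for n
    have ind: "indicator E \<in> L1s_common M N V"
      using E by (intro L1s_common_bounded[of _ 1]) (auto simp: indicator_def)
    define Y where "Y n \<omega> = a n * X \<omega> + b n * indicator E \<omega>" for n \<omega>
    have "pairing Y F \<le> 0"
    proof (rule le)
      show "Y n \<in> L1s_common M N V" for n
        unfolding Y_def[abs_def] by (intro L1s_common_add L1s_common_cmult X ind)
      have "(\<Sum>n=1..N. a n) = 1" "(\<Sum>n=1..N. b n) = 0"
        using one j by (simp_all add: a_def b_def sum_subtractf flip: sum_distrib_left)
      then show "(\<Sum>n=1..N. Y n \<omega>) = X \<omega>" for \<omega>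
        by (simp add: Y_def sum.distrib flip: sum_distrib_right)
    qed
    moreover have "(LINT \<omega>|M. F n \<omega> * Y n \<omega>)
        = a n * (LINT \<omega>|M. F n \<omega> * X \<omega>) + b n * (LINT \<omega>|M. F n \<omega> * indicator E \<omega>)" if n: "n \<in> {1..N}" for n
    proof -
      note [simp] = L1s_common_integrable[OF F X n] L1s_common_integrable[OF F ind n]
      have "(LINT \<omega>|M. F n \<omega> * Y n \<omega>)
          = (LINT \<omega>|M. a n * (F n \<omega> * X \<omega>) + b n * (F n \<omega> * indicator E \<omega>))"
        by (intro Bochner_Integration.integral_cong) (simp_all add: Y_def algebra_simps)
      then show ?thesis by simp
    qed
    ultimately have "(\<Sum>n=1..N. a n * (LINT \<omega>|M. F n \<omega> * X \<omega>) + b n * (LINT \<omega>|M. F n \<omega> * indicator E \<omega>)) \<le> 0"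
      by (simp add: pairing_def)
    moreover have "(\<Sum>n=1..N. a n * p n) = p 1" for p :: "nat \<Rightarrow> real"
      using one by (simp add: a_def if_distrib[of "\<lambda>x. x * _"] cong: if_cong)
    moreover have "(\<Sum>n=1..N. b n * q n) = t * (q 1 - q j)" for q :: "nat \<Rightarrow> real"
    proof -
      have "b n * q n = t * ((if n = 1 then q n else 0) - (if n = j then q n else 0))" for n by (simp add: b_def)
      then show ?thesis using one j by (simp add: sum_subtractf flip: sum_distrib_left)
    qed
    ultimately show ?thesis by (simp add: sum.distrib)
  qed
  show "(LINT \<omega>|M. F 1 \<omega> * X \<omega>) \<le> 0" using key[OF one, of "{}" 0] by simp
  assume j: "j \<in> {1..N}"
  show "density M (\<lambda>\<omega>. ennreal (F j \<omega>)) = density M (\<lambda>\<omega>. ennreal (F 1 \<omega>))"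
  proof (rule measure_eqI)
    fix E assume "E \<in> sets (density M (\<lambda>\<omega>. ennreal (F j \<omega>)))"
    then have E: "E \<in> sets M" by simp
    let ?q = "\<lambda>n. LINT \<omega>|M. F n \<omega> * indicator E \<omega>"
    have "?q 1 = ?q j"
    proof (rule ccontr)
      assume ne: "?q 1 \<noteq> ?q j"
      define p where "p = (LINT \<omega>|M. F 1 \<omega> * X \<omega>)"
      \<comment> \<open>The multiple \<open>t\<close> for which the affine function takes the value 1.\<close>
      have "p + (1 - p) / (?q 1 - ?q j) * (?q 1 - ?q j) \<le> 0"
        unfolding p_def by (rule key[OF j E])
      with ne show False by simp
    qed
    moreover have "emeasure (density M (\<lambda>\<omega>. ennreal (F n \<omega>))) E = ennreal (?q n)" if n: "n \<in> {1..N}" for n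
    proof -
      have ind: "(indicator E :: 'a \<Rightarrow> real) \<in> L1s_common M N V"
        using E by (intro L1s_common_bounded[of _ 1]) (auto simp: indicator_def)
      note [measurable] = densitiesD(1)[OF tuplesD[OF F n]] E
      note nn = densitiesD(2)[OF tuplesD[OF F n]]
      have "emeasure (density M (\<lambda>\<omega>. ennreal (F n \<omega>))) E = (\<integral>\<^sup>+\<omega>. ennreal (F n \<omega> * indicator E \<omega>) \<partial>M)"
        using nn by (subst emeasure_density) (auto intro!: nn_integral_cong simp: indicator_def)
      also have "\<dots> = ennreal (?q n)"
        using nn by (intro nn_integral_eq_integral L1s_common_integrable[OF F ind n]) auto
      finally show ?thesis .
    qed
    ultimately show "emeasure (density M (\<lambda>\<omega>. ennreal (F j \<omega>))) E = emeasure (density M (\<lambda>\<omega>. ennreal (F 1 \<omega>))) E"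
      using one j by simp
  qed simp
qed

lemma no_acceptable_iff:
  assumes A: "A \<noteq> {}" "A \<subseteq> L1s_common M N V" "convex_rvs M A"
  shows "A \<inter> acceptable M N V = {} \<longleftrightarrow> (\<Inter>n\<in>{1..N}. V n) \<inter> risk_neutral M A \<noteq> {}"
proof
  assume "(\<Inter>n\<in>{1..N}. V n) \<inter> risk_neutral M A \<noteq> {}"
  then obtain Q where Q: "Q \<in> (\<Inter>n\<in>{1..N}. V n)" "\<forall>X\<in>A. expect Q X \<le> 0" by (auto simp: risk_neutral_def)
  show "A \<inter> acceptable M N V = {}" using expect_sum_pos[OF Q(1)] Q(2) by (force simp: not_less[symmetric])
next
  assume nsao: "A \<inter> acceptable M N V = {}"
  have one: "1 \<in> {1..N}" using N_pos by simp
  obtain F where F: "F \<in> tuples" and le: "\<And>Y X. X \<in> A \<Longrightarrow> (\<And>n. n \<in> {1..N} \<Longrightarrow> Y n \<in> L1s_common M N V) \<Longrightarrow>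
      (AE \<omega> in M. (\<Sum>n=1..N. Y n \<omega>) = X \<omega>) \<Longrightarrow> pairing Y F \<le> 0"
    using separating_tuple[OF A nsao] by blast
  have diag: "(LINT \<omega>|M. F 1 \<omega> * X \<omega>) \<le> 0"
    "j \<in> {1..N} \<Longrightarrow> density M (\<lambda>\<omega>. ennreal (F j \<omega>)) = density M (\<lambda>\<omega>. ennreal (F 1 \<omega>))"
    if X: "X \<in> A" for X j
  proof -
    have XL: "X \<in> L1s_common M N V" using X A(2) by blast
    have "pairing Y F \<le> 0" if "\<And>n. n \<in> {1..N} \<Longrightarrow> Y n \<in> L1s_common M N V"
      "\<And>\<omega>. (\<Sum>n=1..N. Y n \<omega>) = X \<omega>" for Y
      using le[OF X that(1)] that(2) by simp
    note sep = separating_tuple_diagonal[OF XL F this]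
    show "(LINT \<omega>|M. F 1 \<omega> * X \<omega>) \<le> 0" by (rule sep(1))
    show "density M (\<lambda>\<omega>. ennreal (F j \<omega>)) = density M (\<lambda>\<omega>. ennreal (F 1 \<omega>))" if "j \<in> {1..N}"
      by (rule sep(2)[OF _ _ that])
  qed
  define Q where "Q = density M (\<lambda>\<omega>. ennreal (F 1 \<omega>))"
  obtain X0 where X0: "X0 \<in> A" using A(1) by blast
  have QV: "Q \<in> V n" if n: "n \<in> {1..N}" for n
    using densitiesD(3)[OF tuplesD[OF F n]] diag(2)[OF X0 n] by (simp add: Q_def)
  have "expect Q X \<le> 0" if X: "X \<in> A" for X
  proof -
    have XL: "X \<in> L1s M (V 1)" using X A(2) L1s_commonD[OF _ one] by blast
    have "(LINT \<omega>|Q. X \<omega>) \<le> 0"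
      unfolding Q_def L1s_pairing(2)[OF V_ac[OF one] XL tuplesD[OF F one]] by (rule diag(1)[OF X])
    then show ?thesis by (simp add: expect_eq_integral[OF L1s_integrable[OF V_ac[OF one] XL QV[OF one]]])
  qed
  then have "Q \<in> risk_neutral M A" using QV[OF one] V_ac[OF one] by (auto simp: risk_neutral_def)
  with QV show "(\<Inter>n\<in>{1..N}. V n) \<inter> risk_neutral M A \<noteq> {}" by blast
qed

end

theorem theorem5p3:
  fixes M :: "'a measure" and N :: nat and V :: "nat \<Rightarrow> 'a measure set"
    and A :: "('a \<Rightarrow> real) set"
  assumes "prob_space M"
    and "N \<ge> 1"
    and "\<And>n. n \<in> {1..N} \<Longrightarrow> V n \<subseteq> ac_measures M"
    and "\<And>n. n \<in> {1..N} \<Longrightarrow> V n \<noteq> {}"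
    and "\<And>n. n \<in> {1..N} \<Longrightarrow> convex_measures M (V n)"
    and "\<And>n. n \<in> {1..N} \<Longrightarrow> L1_closed M (V n)"
    and "\<And>n. n \<in> {1..N} \<Longrightarrow> uniformly_integrable_measures M (V n)"
    and "A \<noteq> {}"
    and "A \<subseteq> L1s_common M N V"
    and "convex_rvs M A"
  shows "A \<inter> acceptable M N V = {} \<longleftrightarrow> (\<Inter>n\<in>{1..N}. V n) \<inter> risk_neutral M A \<noteq> {}"
proof -
  interpret valuation_family M N V
    using assms(1-7) by (intro valuation_family.intro valuation_family_axioms.intro) auto
  show ?thesis by (rule no_acceptable_iff[OF assms(8-10)])
qed

end
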